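(* Let $\mathfrak{g}$ be a $4$-dimensional unimodular real Lie algebra and $J$ an almost complex structure on $\mathfrak{g}$. The following are equivalent: 0) $J$ is tamed; 1) $\mathcal{B}\cap\Lambda_J^+(\mathfrak{g}^* )=\{0\}$; 2) $h_J^+=b^+(\mathfrak{g})+1$; 3) $h_J^-=b^+(\mathfrak{g})-1$; 4) $H_J^+(\mathfrak{g})$ has signature $(1,b^+(\mathfrak{g}))$.
   Context: $\mathfrak{g}$ is unimodular if $\mathrm{tr}(\mathrm{ad}_\xi)=0$ for all $\xi\in\mathfrak{g}$. $H^*(\mathfrak{g})$ is the Chevalley–Eilenberg cohomology of $(\Lambda^*(\mathfrak{g}^* ),d)$, $d\phi(u,v)=-\phi([u,v])$ on $1$-forms; $\mathcal{B}=d(\mathfrak{g}^* )\subset\Lambda^2(\mathfrak{g}^* )$ is the space of exact $2$-forms. An almost complex structure is a linear automorphism $J$ of the vector space $\mathfrak{g}$ with $J^2=-\mathrm{id}$; $\mathfrak{g}$ carries the orientation induced by $J$. Fix a nonzero $\zeta\in\Lambda^4(\mathfrak{g})$ inducing the orientation; since $\mathfrak{g}$ is unimodular, $(\alpha,\beta)\mapsto(\alpha\wedge\beta)(\zeta)$ on closed $2$-forms induces a symmetric non-degenerate pairing on $H^2(\mathfrak{g})$ of signature $(b^+(\mathfrak{g}),b^+(\mathfrak{g}))$, where $b^+(\mathfrak{g})$ is the maximal dimension of a positive definite subspace. The signature in 4) is that of the restriction of this pairing. $\Lambda_J^{\pm}(\mathfrak{g}^* )$ are the $\pm1$-eigenspaces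 of $\alpha(\cdot,\cdot)\mapsto\alpha(J\cdot,J\cdot)$ on $\Lambda^2(\mathfrak{g}^* )$; $H_J^{\pm}(\mathfrak{g})\subset H^2(\mathfrak{g})$ is the subspace of classes representable by a closed form in $\Lambda_J^\pm(\mathfrak{g}^* )$, and $h_J^\pm=\dim H_J^\pm(\mathfrak{g})$. $J$ is tamed if there exists a closed $2$-form $\varphi$ on $\mathfrak{g}$ with $\varphi(v,Jv)>0$ for all nonzero $v\in\mathfrak{g}$. *)

theory Defs
  imports "HOL-Analysis.Linear_Algebra" "HOL-Algebra.AbelCoset" "Jordan_Normal_Form.VS_Connect"
begin

section \<open>Quotient vector spaces\<close>

text \<open>
  Vector spaces with an explicit carrier are those of the AFP entry VectorSpace, over the field
  \<^term>\<open>class_ring :: real ring\<close>. The scalar action on cosets adds \<open>B\<close> back, so that the coset of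
  \<open>c \<odot> x\<close> is obtained also for \<open>c = 0\<close>.
\<close>

definition quotient_space ::
  "(real, 'v) module \<Rightarrow> 'v set \<Rightarrow> (real, 'v set) module" where
  "quotient_space V B =
    \<lparr>carrier = a_rcosets\<^bsub>V\<^esub> B, mult = undefined, one = undefined, zero = B,
     add = (\<lambda>X Y. X <+>\<^bsub>V\<^esub> Y), smult = (\<lambda>c X. B <+>\<^bsub>V\<^esub> (\<lambda>x. c \<odot>\<^bsub>V\<^esub> x) ` X)\<rparr>"

abbreviation real_subspace :: "'v set \<Rightarrow> (real, 'v) module \<Rightarrow> bool" where
  "real_subspace W V \<equiv> VectorSpace.subspace class_ring W V"

abbreviation subspace_dim :: "(real, 'v) module \<Rightarrow> 'v set \<Rightarrow> nat" where
  "subspace_dim V W \<equiv> vectorspace.dim class_ring (V\<lparr>carrier := W\<rparr>)"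

lemma quotient_space_vectorspace:
  fixes V :: "(real, 'v) module"
  assumes "vectorspace class_ring V" "real_subspace B V"
  shows "vectorspace class_ring (quotient_space V B)"
proof -
  interpret V: vectorspace class_ring V by fact
  have sm: "submodule class_ring B V" using assms(2) by (simp add: VectorSpace.subspace_def)
  have Bsub: "B \<subseteq> carrier V" and B0: "\<zero>\<^bsub>V\<^esub> \<in> B"
    and Badd: "\<And>x y. x \<in> B \<Longrightarrow> y \<in> B \<Longrightarrow> x \<oplus>\<^bsub>V\<^esub> y \<in> B"
    and Bsm: "\<And>c x. x \<in> B \<Longrightarrow> c \<odot>\<^bsub>V\<^esub> x \<in> B"
    using sm by (auto simp: submodule_def)
  have neg: "\<ominus>\<^bsub>V\<^esub> x = (-1) \<odot>\<^bsub>V\<^esub> x" if "x \<in> carrier V" for x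
    using V.smult_l_minus[of 1 x] V.smult_one[of x] that by (simp add: class_ring_simps)
  have asg: "additive_subgroup B V"
  proof (rule additive_subgroupI, rule group.subgroupI[OF V.a_group], goal_cases)
    case (3 a) then show ?case using neg[of a] Bsub Bsm by (auto simp: a_inv_def[symmetric])
  qed (use Bsub B0 Badd in auto)
  interpret B: abelian_subgroup B V
    by (intro abelian_subgroupI3 asg) (rule V.abelian_group_axioms)
  let ?c = "\<lambda>x. B +>\<^bsub>V\<^esub> x"
  have sm: "B <+>\<^bsub>V\<^esub> (\<lambda>x. c \<odot>\<^bsub>V\<^esub> x) ` ?c x = ?c (c \<odot>\<^bsub>V\<^esub> x)" if x: "x \<in> carrier V" for c x
  proof safe
    fix y assume "y \<in> B <+>\<^bsub>V\<^esub> (\<lambda>x. c \<odot>\<^bsub>V\<^esub> x) ` ?c x"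
    then obtain b b' where b: "b \<in> B" "b' \<in> B" "y = b \<oplus>\<^bsub>V\<^esub> c \<odot>\<^bsub>V\<^esub> (b' \<oplus>\<^bsub>V\<^esub> x)"
      by (auto simp: set_add_def' a_r_coset_def')
    then have "y = (b \<oplus>\<^bsub>V\<^esub> c \<odot>\<^bsub>V\<^esub> b') \<oplus>\<^bsub>V\<^esub> c \<odot>\<^bsub>V\<^esub> x"
      using x Bsub by (auto simp: V.smult_r_distr V.a_assoc subset_iff)
    then show "y \<in> ?c (c \<odot>\<^bsub>V\<^esub> x)" using b Badd Bsm by (auto simp: a_r_coset_def')
  next
    fix y assume "y \<in> ?c (c \<odot>\<^bsub>V\<^esub> x)"
    then obtain b where b: "b \<in> B" "y = b \<oplus>\<^bsub>V\<^esub> c \<odot>\<^bsub>V\<^esub> x" by (auto simp: a_r_coset_def')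
    have "x \<in> ?c x" using x B0 by (force simp: a_r_coset_def')
    then show "y \<in> B <+>\<^bsub>V\<^esub> (\<lambda>x. c \<odot>\<^bsub>V\<^esub> x) ` ?c x" using b by (auto simp: set_add_def')
  qed
  have ad: "?c x <+>\<^bsub>V\<^esub> ?c y = ?c (x \<oplus>\<^bsub>V\<^esub> y)" if "x \<in> carrier V" "y \<in> carrier V" for x y
    using that by (simp add: B.a_rcos_sum)
  have z: "B = ?c \<zero>\<^bsub>V\<^esub>" using Bsub by (simp add: V.a_coset_add_zero)
  let ?Q = "quotient_space V B"
  have Q: "carrier ?Q = ?c ` carrier V" "\<zero>\<^bsub>?Q\<^esub> = ?c \<zero>\<^bsub>V\<^esub>" 
    by (auto simp: quotient_space_def A_RCOSETS_def' z[symmetric])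
  have Qa: "?c x \<oplus>\<^bsub>?Q\<^esub> ?c y = ?c (x \<oplus>\<^bsub>V\<^esub> y)" if "x \<in> carrier V" "y \<in> carrier V" for x y
    using ad that by (simp add: quotient_space_def)
  have Qs: "c \<odot>\<^bsub>?Q\<^esub> ?c x = ?c (c \<odot>\<^bsub>V\<^esub> x)" if "x \<in> carrier V" for x c
    using sm that by (simp add: quotient_space_def)
  have sc: "c \<odot>\<^bsub>V\<^esub> x \<in> carrier V" if "x \<in> carrier V" for x c using that V.smult_closed[of c x] by simp
  show ?thesis
  proof (rule vs_criteria[OF class_field], goal_cases)
    case 3 
    show ?case
    proof
      fix v assume "v \<in> carrier ?Q"
      then obtain x where "x \<in> carrier V" "v = ?c x" by (auto simp: Q)
      then show "\<exists>n\<in>carrier ?Q. v \<oplus>\<^bsub>?Q\<^esub> n = \<zero>\<^bsub>?Q\<^esub>"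
        by (intro bexI[of _ "?c (\<ominus>\<^bsub>V\<^esub> x)"]) (auto simp: Q Qa V.r_neg)
    qed
  qed (insert V.smult_l_distr V.smult_assoc1 V.smult_one, auto simp: Q Qa Qs sc V.a_ac V.smult_r_distr)
qed


section \<open>Indices of a symmetric bilinear form\<close>

definition pos_index ::
  "(real, 'v) module \<Rightarrow> ('v \<Rightarrow> 'v \<Rightarrow> real) \<Rightarrow> 'v set \<Rightarrow> nat" where
  "pos_index V q W = Max {subspace_dim V U | U.
     real_subspace U V \<and> U \<subseteq> W \<and> (\<forall>x\<in>U. x \<noteq> \<zero>\<^bsub>V\<^esub> \<longrightarrow> q x x > 0)}"

definition neg_index ::
  "(real, 'v) module \<Rightarrow> ('v \<Rightarrow> 'v \<Rightarrow> real) \<Rightarrow> 'v set \<Rightarrow> nat" where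
  "neg_index V q W = pos_index V (\<lambda>x y. - q x y) W"

definition signature ::
  "(real, 'v) module \<Rightarrow> ('v \<Rightarrow> 'v \<Rightarrow> real) \<Rightarrow> 'v set \<Rightarrow> nat \<times> nat" where
  "signature V q W = (pos_index V q W, neg_index V q W)"


section \<open>Lie algebras\<close>

definition lie_bracket :: "('a::real_vector \<Rightarrow> 'a \<Rightarrow> 'a) \<Rightarrow> bool" where
  "lie_bracket br \<longleftrightarrow> bilinear br \<and> (\<forall>u. br u u = 0) \<and>
     (\<forall>u v w. br u (br v w) + br v (br w u) + br w (br u v) = 0)"

text \<open>\<^term>\<open>extend_basis {}\<close> is some basis of the whole space.\<close>

definition linear_trace :: "('a::real_vector \<Rightarrow> 'a) \<Rightarrow> real" where
  "linear_trace f =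
     (\<Sum>b\<in>extend_basis {}. representation (extend_basis {}) (f b) b)"

definition unimodular :: "('a::real_vector \<Rightarrow> 'a \<Rightarrow> 'a) \<Rightarrow> bool" where
  "unimodular br \<longleftrightarrow> (\<forall>\<xi>. linear_trace (br \<xi>) = 0)"


section \<open>Invariant forms and the Chevalley--Eilenberg differential\<close>

type_synonym 'a form2 = "'a \<Rightarrow> 'a \<Rightarrow> real"
type_synonym 'a form3 = "'a \<Rightarrow> 'a \<Rightarrow> 'a \<Rightarrow> real"
type_synonym 'a form4 = "'a \<Rightarrow> 'a \<Rightarrow> 'a \<Rightarrow> 'a \<Rightarrow> real"

definition Forms2 :: "'a::real_vector form2 set" where
  "Forms2 = {\<alpha>. bilinear \<alpha> \<and> (\<forall>u. \<alpha> u u = 0)}"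

definition Forms4 :: "'a::real_vector form4 set" where
  "Forms4 = {\<omega>.
     (\<forall>b c d. linear (\<lambda>a. \<omega> a b c d)) \<and> (\<forall>a c d. linear (\<lambda>b. \<omega> a b c d)) \<and>
     (\<forall>a b d. linear (\<lambda>c. \<omega> a b c d)) \<and> (\<forall>a b c. linear (\<lambda>d. \<omega> a b c d)) \<and>
     (\<forall>u v w. \<omega> u u v w = 0 \<and> \<omega> u v u w = 0 \<and> \<omega> u v w u = 0 \<and>
               \<omega> v u u w = 0 \<and> \<omega> v u w u = 0 \<and> \<omega> v w u u = 0)}"

definition forms2_space :: "(real, 'a::real_vector form2) module" where
  "forms2_space =
    \<lparr>carrier = Forms2, mult = undefined, one = undefined, zero = (\<lambda>u v. 0),
     add = (\<lambda>\<alpha> \<beta> u v. \<alpha> u v + \<beta> u v), smult = (\<lambda>c \<alpha> u v. c * \<alpha> u v)\<rparr>"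

definition d1 :: "('a \<Rightarrow> 'a \<Rightarrow> 'a) \<Rightarrow> ('a \<Rightarrow> real) \<Rightarrow> 'a form2" where
  "d1 br \<phi> = (\<lambda>u v. - \<phi> (br u v))"

definition d2 :: "('a \<Rightarrow> 'a \<Rightarrow> 'a) \<Rightarrow> 'a form2 \<Rightarrow> 'a form3" where
  "d2 br \<alpha> = (\<lambda>u v w. - \<alpha> (br u v) w + \<alpha> (br u w) v - \<alpha> (br v w) u)"

definition exact2 :: "('a::real_vector \<Rightarrow> 'a \<Rightarrow> 'a) \<Rightarrow> 'a form2 set" where
  "exact2 br = d1 br ` {\<phi>. linear \<phi>}"

definition closed2 :: "('a::real_vector \<Rightarrow> 'a \<Rightarrow> 'a) \<Rightarrow> 'a form2 set" where
  "closed2 br = {\<alpha> \<in> Forms2. d2 br \<alpha> = (\<lambda>u v w. 0)}"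

definition closed2_space ::
  "('a::real_vector \<Rightarrow> 'a \<Rightarrow> 'a) \<Rightarrow> (real, 'a form2) module" where
  "closed2_space br = forms2_space\<lparr>carrier := closed2 br\<rparr>"

definition H2 :: "('a::real_vector \<Rightarrow> 'a \<Rightarrow> 'a) \<Rightarrow> (real, 'a form2 set) module" where
  "H2 br = quotient_space (closed2_space br) (exact2 br)"

definition coh_class ::
  "('a::real_vector \<Rightarrow> 'a \<Rightarrow> 'a) \<Rightarrow> 'a form2 \<Rightarrow> 'a form2 set" where
  "coh_class br \<alpha> = exact2 br +>\<^bsub>closed2_space br\<^esub> \<alpha>"

lemma closed2_iff: "\<alpha> \<in> closed2 br \<longleftrightarrow> (\<forall>u. linear (\<alpha> u)) \<and> (\<forall>v. linear (\<lambda>u. \<alpha> u v)) \<and>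
   (\<forall>u. \<alpha> u u = 0) \<and> (\<forall>u v w. \<alpha> (br u v) w - \<alpha> (br u w) v + \<alpha> (br v w) u = 0)"
proof -
  have 1: "(- a + b - c = 0) = (a - b + c = 0)" for a b c :: real by linarith
  show ?thesis unfolding closed2_def Forms2_def bilinear_def d2_def fun_eq_iff mem_Collect_eq 1 by blast
qed

lemma closed2_add: assumes "v \<in> closed2 br" "w \<in> closed2 br" shows "(\<lambda>x y. v x y + w x y) \<in> closed2 br"
proof -
  have a: "linear (v x)" "linear (\<lambda>u. v u x)" "v x x = 0" "v (br x y) z - v (br x z) y + v (br y z) x = 0" for x y z
    using assms(1) unfolding closed2_iff by blast+
  have b: "linear (w x)" "linear (\<lambda>u. w u x)" "w x x = 0" "w (br x y) z - w (br x z) y + w (br y z) x = 0" for x y z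
    using assms(2) unfolding closed2_iff by blast+
  show ?thesis unfolding closed2_iff
  proof (intro conjI allI)
    show "linear (\<lambda>y. v x y + w x y)" for x by (rule linear_compose_add[OF a(1) b(1)])
    show "linear (\<lambda>x. v x y + w x y)" for y by (rule linear_compose_add[OF a(2) b(2)])
    show "v x x + w x x = 0" for x using a(3)[of x] b(3)[of x] by linarith
    show "v (br x y) z + w (br x y) z - (v (br x z) y + w (br x z) y) + (v (br y z) x + w (br y z) x) = 0" for x y z
      using a(4)[of x y z] b(4)[of x y z] by linarith
  qed
qed

lemma closed2_scale: assumes "v \<in> closed2 br" shows "(\<lambda>x y. c * v x y) \<in> closed2 br"
proof -
  have a: "linear (v x)" "linear (\<lambda>u. v u x)" "v x x = 0" "v (br x y) z - v (br x z) y + v (br y z) x = 0" for x y z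
    using assms(1) unfolding closed2_iff by blast+
  show ?thesis unfolding closed2_iff
  proof (intro conjI allI)
    show "linear (\<lambda>y. c * v x y)" for x using linear_compose_scale_right[OF a(1), of c x] by simp
    show "linear (\<lambda>x. c * v x y)" for y using linear_compose_scale_right[OF a(2), of c y] by simp
    show "c * v x x = 0" for x using a(3)[of x] by simp
    show "c * v (br x y) z - c * v (br x z) y + c * v (br y z) x = 0" for x y z
      using arg_cong[OF a(4)[of x y z], of "\<lambda>t. c * t"] by (simp only: distrib_left right_diff_distrib mult_zero_right)
  qed
qed

lemma closed2_zero: "(\<lambda>x y. 0) \<in> closed2 br"
  unfolding closed2_iff by (simp add: linear_iff)

lemma closed2_vectorspace: "vectorspace class_ring (closed2_space br)"
proof (rule vs_criteria[OF class_field], goal_cases)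
  case 3 show ?case
  proof
    fix v assume "v \<in> carrier (closed2_space br)"
    then show "\<exists>n\<in>carrier (closed2_space br). v \<oplus>\<^bsub>closed2_space br\<^esub> n = \<zero>\<^bsub>closed2_space br\<^esub>"
      using closed2_scale[of v br "-1"]
      by (intro bexI[of _ "\<lambda>x y. -1 * v x y"]) (simp_all add: closed2_space_def forms2_space_def)
  qed
qed (simp_all add: closed2_space_def forms2_space_def closed2_add closed2_scale closed2_zero distrib_left distrib_right add.assoc mult.assoc, simp_all add: add.commute)

lemma exact2_subset_closed2: assumes "lie_bracket br" shows "exact2 br \<subseteq> closed2 br"
proof
  fix \<alpha> assume "\<alpha> \<in> exact2 br"
  then obtain \<phi> where p: "linear \<phi>" "\<alpha> = d1 br \<phi>" by (auto simp: exact2_def)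
  have b: "bilinear br" and z: "br u u = 0" and j: "br u (br v w) + br v (br w u) + br w (br u v) = 0" for u v w
    using assms by (auto simp: lie_bracket_def)
  have anti: "br u v = - br v u" for u v
    using z[of "u+v"] z[of u] z[of v] b by (simp add: bilinear_ladd bilinear_radd eq_neg_iff_add_eq_0)
  have "d2 br \<alpha> u v w = 0" for u v w
  proof -
    have "d2 br \<alpha> u v w = \<phi> (br (br u v) w - br (br u w) v + br (br v w) u)"
      using p by (simp add: d1_def d2_def linear_add linear_diff)
    also have "br (br u v) w - br (br u w) v + br (br v w) u = - (br u (br v w) + br v (br w u) + br w (br u v))"
      using anti[of "br u v" w] anti[of "br u w" v] anti[of "br v w" u] anti[of u w] b by (simp add: bilinear_rneg)
    finally show ?thesis using j p by (simp add: linear_0)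
  qed
  then have "d2 br \<alpha> = (\<lambda>u v w. 0)" by (intro ext)
  moreover have "\<alpha> \<in> Forms2" using p b z
    by (auto simp: Forms2_def d1_def bilinear_def linear_iff linear_0)
  ultimately show "\<alpha> \<in> closed2 br" by (simp add: closed2_def)
qed

lemma exact2_subspace: assumes "lie_bracket br" shows "real_subspace (exact2 br) (closed2_space br)"
  unfolding VectorSpace.subspace_def submodule_def
proof (intro conjI allI impI closed2_vectorspace)
  show "Module.module class_ring (closed2_space br)" using closed2_vectorspace[of br] by (simp add: vectorspace_def)
  show "exact2 br \<subseteq> carrier (closed2_space br)" using exact2_subset_closed2[OF assms] by (simp add: closed2_space_def)
  have "(\<lambda>u v. 0) = d1 br (\<lambda>x. 0)" by (simp add: d1_def)
  then show "\<zero>\<^bsub>closed2_space br\<^esub> \<in> exact2 br" by (auto simp: closed2_space_def forms2_space_def exact2_def linear_iff)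
next
  fix v w assume "v \<in> exact2 br" "w \<in> exact2 br"
  then obtain p q where p: "linear p" "linear q" "v = d1 br p" "w = d1 br q" by (auto simp: exact2_def)
  have "v \<oplus>\<^bsub>closed2_space br\<^esub> w = d1 br (\<lambda>x. p x + q x)" using p by (simp add: closed2_space_def forms2_space_def d1_def fun_eq_iff)
  moreover have "linear (\<lambda>x. p x + q x)" using p by (simp add: linear_compose_add)
  ultimately show "v \<oplus>\<^bsub>closed2_space br\<^esub> w \<in> exact2 br" by (auto simp: exact2_def)
next
  fix c v assume "v \<in> exact2 br"
  then obtain p where p: "linear p" "v = d1 br p" by (auto simp: exact2_def)
  have "c \<odot>\<^bsub>closed2_space br\<^esub> v = d1 br (\<lambda>x. c * p x)" using p by (simp add: closed2_space_def forms2_space_def d1_def)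
  moreover have "linear (\<lambda>x. c * p x)" using p by (simp add: linear_iff algebra_simps)
  ultimately show "c \<odot>\<^bsub>closed2_space br\<^esub> v \<in> exact2 br" by (auto simp: exact2_def)
qed

lemma H2_vectorspace: "lie_bracket br \<Longrightarrow> vectorspace class_ring (H2 br)"
  unfolding H2_def by (intro quotient_space_vectorspace closed2_vectorspace exact2_subspace)


section \<open>Almost complex structures\<close>

definition almost_complex :: "('a::real_vector \<Rightarrow> 'a) \<Rightarrow> bool" where
  "almost_complex J \<longleftrightarrow> linear J \<and> (\<forall>v. J (J v) = - v)"

text \<open>The eigenspaces \<open>\<Lambda>\<^sub>J\<^sup>+\<close> and \<open>\<Lambda>\<^sub>J\<^sup>-\<close> are obtained for \<open>s = 1\<close> and \<open>s = -1\<close>, and likewise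
  \<open>H\<^sub>J\<^sup>+\<close>, \<open>H\<^sub>J\<^sup>-\<close> and \<open>h\<^sub>J\<^sup>+\<close>, \<open>h\<^sub>J\<^sup>-\<close> below.\<close>

definition Forms2_J :: "('a::real_vector \<Rightarrow> 'a) \<Rightarrow> real \<Rightarrow> 'a form2 set" where
  "Forms2_J J s = {\<alpha> \<in> Forms2. \<forall>u v. \<alpha> (J u) (J v) = s * \<alpha> u v}"

definition H_J ::
  "('a::real_vector \<Rightarrow> 'a \<Rightarrow> 'a) \<Rightarrow> ('a \<Rightarrow> 'a) \<Rightarrow> real \<Rightarrow> 'a form2 set set" where
  "H_J br J s = coh_class br ` (closed2 br \<inter> Forms2_J J s)"

definition h_J ::
  "('a::real_vector \<Rightarrow> 'a \<Rightarrow> 'a) \<Rightarrow> ('a \<Rightarrow> 'a) \<Rightarrow> real \<Rightarrow> nat" where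
  "h_J br J s = subspace_dim (H2 br) (H_J br J s)"

definition tamed :: "('a::real_vector \<Rightarrow> 'a \<Rightarrow> 'a) \<Rightarrow> ('a \<Rightarrow> 'a) \<Rightarrow> bool" where
  "tamed br J \<longleftrightarrow> (\<exists>\<phi>\<in>closed2 br. \<forall>v. v \<noteq> 0 \<longrightarrow> \<phi> v (J v) > 0)"


section \<open>Orientation and the intersection pairing\<close>

text \<open>\<open>\<Lambda>\<^sup>4(\<gg>)\<close> is identified with the dual of \<open>\<Lambda>\<^sup>4(\<gg>\<^sup>*)\<close>; the multivector
  \<open>a \<and> b \<and> c \<and> d\<close> is evaluation at \<open>(a, b, c, d)\<close>. Values of the functional outside
  \<^term>\<open>Forms4\<close> are irrelevant.\<close>

definition Multivectors4 :: "('a::real_vector form4 \<Rightarrow> real) set" where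
  "Multivectors4 = {\<zeta>.
     (\<forall>\<omega>\<in>Forms4. \<forall>\<eta>\<in>Forms4. \<zeta> (\<lambda>a b c d. \<omega> a b c d + \<eta> a b c d) = \<zeta> \<omega> + \<zeta> \<eta>) \<and>
     (\<forall>r. \<forall>\<omega>\<in>Forms4. \<zeta> (\<lambda>a b c d. r * \<omega> a b c d) = r * \<zeta> \<omega>)}"

text \<open>The orientation induced by \<open>J\<close> is the one of the bases \<open>(e, J e, f, J f)\<close>, so \<open>\<zeta>\<close> induces it
  iff it is a positive multiple of \<open>e \<and> J e \<and> f \<and> J f\<close> for such a basis.\<close>

definition induces_orientation ::
  "('a::real_vector \<Rightarrow> 'a) \<Rightarrow> ('a form4 \<Rightarrow> real) \<Rightarrow> bool" where
  "induces_orientation J \<zeta> \<longleftrightarrow>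
     (\<exists>e f r. distinct [e, J e, f, J f] \<and> independent {e, J e, f, J f} \<and>
        span {e, J e, f, J f} = UNIV \<and> r > 0 \<and>
        (\<forall>\<omega>\<in>Forms4. \<zeta> \<omega> = r * \<omega> e (J e) f (J f)))"

definition wedge22 :: "'a form2 \<Rightarrow> 'a form2 \<Rightarrow> 'a form4" where
  "wedge22 \<alpha> \<beta> = (\<lambda>a b c d.
     \<alpha> a b * \<beta> c d - \<alpha> a c * \<beta> b d + \<alpha> a d * \<beta> b c +
     \<alpha> b c * \<beta> a d - \<alpha> b d * \<beta> a c + \<alpha> c d * \<beta> a b)"

text \<open>For unimodular Lie algebras the value does not depend on the representatives, so the set
  of values is a singleton.\<close>

definition pairing :: "('a form4 \<Rightarrow> real) \<Rightarrow> 'a form2 set \<Rightarrow> 'a form2 set \<Rightarrow> real" where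
  "pairing \<zeta> X Y = the_elem {\<zeta> (wedge22 \<alpha> \<beta>) | \<alpha> \<beta>. \<alpha> \<in> X \<and> \<beta> \<in> Y}"

definition b_plus ::
  "('a::real_vector \<Rightarrow> 'a \<Rightarrow> 'a) \<Rightarrow> ('a form4 \<Rightarrow> real) \<Rightarrow> nat" where
  "b_plus br \<zeta> = pos_index (H2 br) (pairing \<zeta>) (carrier (H2 br))"

end

theory Submission
  imports Defs
begin

text \<open>
  In a frame \<open>(e, J e, f, J f)\<close> that defines the orientation, the wedge product makes
  \<open>\<Lambda>\<^sup>2(\<gg>\<^sup>*)\<close> a six-dimensional space with a form of signature \<open>(3,3)\<close>. It is the orthogonal sum
  of the Lorentzian space \<open>\<Lambda>\<^sub>J\<^sup>+\<close>, of signature \<open>(1,3)\<close>, and the positive definite plane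
  \<open>\<Lambda>\<^sub>J\<^sup>-\<close>. In a unimodular algebra every 3-form is closed, whence \<open>d\<phi> \<and> \<alpha> = \<phi> \<and> d\<alpha>\<close>; so the closed
  2-forms \<open>Z\<close> are exactly the orthogonal complement of the exact ones \<open>B\<close>. The theorem is thus a
  statement about a single isotropic subspace \<open>B\<close> of a split space (locale \<open>isotropic_subspace\<close>).

  Put \<open>k = dim B\<close> and \<open>d = dim (B \<inter> \<Lambda>\<^sub>J\<^sup>+)\<close>. Then \<open>B\<^sup>\<bottom> / B\<close> has signature
  \<open>(3 - k, 3 - k)\<close>, so \<open>b\<^sup>+ = 3 - k\<close>. Since \<open>B\<close> meets the definite plane \<open>\<Lambda>\<^sub>J\<^sup>-\<close> only in \<open>0\<close>,
  counting dimensions of orthogonal complements gives \<open>h\<^sub>J\<^sup>+ = b\<^sup>+ + 1 - d\<close> and \<open>h\<^sub>J\<^sup>- = b\<^sup>+ - 1 + d\<close>.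
  The negative index of \<open>H\<^sub>J\<^sup>+\<close> is always \<open>b\<^sup>+\<close>, and its positive index is \<open>1\<close> if \<open>d = 0\<close> and \<open>0\<close>
  otherwise: a nonzero element of \<open>B \<inter> \<Lambda>\<^sub>J\<^sup>+\<close> is a null vector, and in a Lorentzian space
  nothing orthogonal to a null vector has positive square (\<open>light_cone\<close>).

  Tameness fits in because a form \<open>\<phi>\<close> that is positive on all \<open>(v, J v)\<close>, \<open>v \<noteq> 0\<close>, has a \<open>\<Lambda>\<^sub>J\<^sup>+\<close> component of
  positive square, which by the same argument excludes \<open>d \<noteq> 0\<close> when \<open>\<phi>\<close> is closed. Conversely, if
  \<open>d = 0\<close> then the projection of \<open>Z\<close> to \<open>\<Lambda>\<^sub>J\<^sup>+\<close> is onto (\<open>exists_closed_lift\<close>), so a positive element of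
  \<open>\<Lambda>\<^sub>J\<^sup>+\<close> can be corrected by an element of \<open>\<Lambda>\<^sub>J\<^sup>-\<close>, which vanishes on all \<open>(v, J v)\<close>, to a closed form.
\<close>

hide_const (open) VectorSpace.subspace
hide_fact (open) VectorSpace.subspace_def

section \<open>Isotropic subspaces of a split quadratic space\<close>

definition pos_dim :: "('e::real_vector \<Rightarrow> 'e \<Rightarrow> real) \<Rightarrow> 'e set \<Rightarrow> nat" where
  "pos_dim q W = Max {dim S | S. subspace S \<and> S \<subseteq> W \<and> (\<forall>x\<in>S. x \<noteq> 0 \<longrightarrow> q x x > 0)}"

lemma pos_dim_eqI:
  assumes "subspace S" "S \<subseteq> W" "\<And>x. x \<in> S \<Longrightarrow> x \<noteq> 0 \<Longrightarrow> q x x > 0" "dim S = d"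
    and "\<And>S. subspace S \<Longrightarrow> S \<subseteq> W \<Longrightarrow> (\<And>x. x \<in> S \<Longrightarrow> x \<noteq> 0 \<Longrightarrow> q x x > 0) \<Longrightarrow> dim S \<le> d"
  shows "pos_dim q W = d"
  unfolding pos_dim_def
proof (rule Max_eqI)
  show "finite {dim S |S. subspace S \<and> S \<subseteq> W \<and> (\<forall>x\<in>S. x \<noteq> 0 \<longrightarrow> 0 < q x x)}"
    by (rule finite_subset[of _ "{..d}"]) (use assms(5) in auto)
qed (use assms in blast)+

lemma dim_Int_lower:
  fixes S T W :: "'e::euclidean_space set"
  assumes "subspace S" "subspace T" "subspace W" "S \<subseteq> W" "T \<subseteq> W"
  shows "dim S + dim T \<le> dim W + dim (S \<inter> T)"
proof -
  have "dim {x + y |x y. x \<in> S \<and> y \<in> T} \<le> dim W"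
    by (rule dim_subset) (use assms in \<open>auto intro: subspace_add\<close>)
  then show ?thesis using dim_sums_Int[OF assms(1,2)] by linarith
qed

lemma dim_add_le_disjoint:
  fixes S T W :: "'e::euclidean_space set"
  assumes "subspace S" "subspace T" "subspace W" "S \<subseteq> W" "T \<subseteq> W" "S \<inter> T \<subseteq> {0}"
  shows "dim S + dim T \<le> dim W"
  using dim_Int_lower[OF assms(1-5)] assms(6) by (simp add: dim_eq_0[THEN iffD2])

lemma dim_sums_disjoint:
  fixes S T :: "'e::euclidean_space set"
  assumes "subspace S" "subspace T" "S \<inter> T \<subseteq> {0}"
  shows "dim {x + y |x y. x \<in> S \<and> y \<in> T} = dim S + dim T"
  using dim_sums_Int[OF assms(1,2)] assms(3) by (simp add: dim_eq_0[THEN iffD2])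

text \<open>
  The model of \<open>\<Lambda>\<^sup>2(\<gg>\<^sup>*)\<close>: the first factor and the last one span \<open>\<Lambda>\<^sub>J\<^sup>+\<close>, the middle one is
  \<open>\<Lambda>\<^sub>J\<^sup>-\<close>. The parts below that are invariant and anti-invariant under \<open>J\<close> model these two spaces.
\<close>

definition split_form ::
  "real \<times> 'w::euclidean_space \<times> 'm::euclidean_space \<Rightarrow> real \<times> 'w \<times> 'm \<Rightarrow> real" where
  "split_form x y = fst x * fst y + fst (snd x) \<bullet> fst (snd y) - snd (snd x) \<bullet> snd (snd y)"

definition inv_part :: "(real \<times> 'w::euclidean_space \<times> 'm::euclidean_space) set" where
  "inv_part = {x. fst (snd x) = 0}"
definition anti_part :: "(real \<times> 'w::euclidean_space \<times> 'm::euclidean_space) set" where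
  "anti_part = {x. fst x = 0 \<and> snd (snd x) = 0}"
definition neg_part :: "(real \<times> 'w::euclidean_space \<times> 'm::euclidean_space) set" where
  "neg_part = {x. fst x = 0 \<and> fst (snd x) = 0}"
definition pos_part :: "(real \<times> 'w::euclidean_space \<times> 'm::euclidean_space) set" where
  "pos_part = {x. snd (snd x) = 0}"

lemmas part_defs = inv_part_def anti_part_def neg_part_def pos_part_def

lemma subspace_parts:
  "subspace inv_part" "subspace anti_part" "subspace neg_part" "subspace pos_part"
  by (auto simp: part_defs subspace_def)

lemma parts_as_products:
  "inv_part = UNIV \<times> {0} \<times> UNIV" "anti_part = {0} \<times> UNIV \<times> {0}"
  "neg_part = {0} \<times> {0} \<times> UNIV" "pos_part = UNIV \<times> UNIV \<times> {0}"
  by (auto simp: part_defs)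

lemma dim_parts:
  "dim (inv_part :: (real \<times> 'w::euclidean_space \<times> 'm::euclidean_space) set) = 1 + DIM('m)"
  "dim (anti_part :: (real \<times> 'w \<times> 'm) set) = DIM('w)"
  "dim (neg_part :: (real \<times> 'w \<times> 'm) set) = DIM('m)"
  "dim (pos_part :: (real \<times> 'w \<times> 'm) set) = 1 + DIM('w)"
  by (simp_all add: parts_as_products dim_Times subspace_Times)

lemma split_form_linear: 
  "split_form (x + y) z = split_form x z + split_form y z"
  "split_form z (x + y) = split_form z x + split_form z y"
  "split_form (x - y) z = split_form x z - split_form y z"
  "split_form z (x - y) = split_form z x - split_form z y"
  "split_form (c *\<^sub>R x) z = c * split_form x z"
  "split_form z (c *\<^sub>R x) = c * split_form z x"
  "split_form 0 z = 0" "split_form z 0 = 0"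
  "split_form (- x) z = - split_form x z" "split_form z (- x) = - split_form z x"
  by (simp_all add: split_form_def inner_simps algebra_simps)

lemma split_form_commute: "split_form x y = split_form y x"
  by (simp add: split_form_def inner_commute mult.commute)

definition form_orth where "form_orth A = {x. \<forall>y\<in>A. split_form y x = 0}"

lemma subspace_form_orth: "subspace (form_orth A)"
  by (auto simp: form_orth_def subspace_def split_form_linear)

text \<open>
  The form is the inner product twisted by the reflection in the last factor, so its orthogonal
  complements are Euclidean ones of reflected subspaces.
\<close>

lemma dim_form_orth:
  fixes A :: "(real \<times> 'w::euclidean_space \<times> 'm::euclidean_space) set"
  assumes "subspace A"
  shows "dim (form_orth A) + dim A = 1 + DIM('w) + DIM('m)"
proof -
  define f :: "real \<times> 'w \<times> 'm \<Rightarrow> real \<times> 'w \<times> 'm" where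
    "f = (\<lambda>x. (fst x, fst (snd x), - snd (snd x)))"
  have lin: "linear f" by (auto simp: f_def linear_iff)
  have inj: "inj f" by (auto simp: f_def inj_on_def prod_eq_iff)
  have f: "split_form y x = f y \<bullet> x" for x y
    by (simp add: f_def split_form_def inner_prod_def)
  have "form_orth A = {y \<in> UNIV. \<forall>x\<in>f ` A. Linear_Algebra.orthogonal x y}"
    by (auto simp: form_orth_def f Linear_Algebra.orthogonal_def)
  moreover have "dim (f ` A) = dim A"
    by (rule dim_image_eq[OF lin]) (use inj in \<open>auto intro: inj_on_subset\<close>)
  ultimately show ?thesis
    using dim_subspace_orthogonal_to_vectors[of "f ` A" UNIV] assms lin
    by (simp add: linear_subspace_image)
qed

lemma form_orth_sums:
  assumes "subspace S" "subspace T"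
  shows "form_orth {x + y |x y. x \<in> S \<and> y \<in> T} = form_orth S \<inter> form_orth T"
proof (intro equalityI subsetI)
  fix z assume z: "z \<in> form_orth {x + y |x y. x \<in> S \<and> y \<in> T}"
  have z: "split_form (x + y) z = 0" if "x \<in> S" "y \<in> T" for x y
    using z that unfolding form_orth_def by blast
  have "split_form x z = 0" if "x \<in> S" for x
    using z[OF that subspace_0[OF assms(2)]] by simp
  moreover have "split_form y z = 0" if "y \<in> T" for y
    using z[OF subspace_0[OF assms(1)] that] by simp
  ultimately show "z \<in> form_orth S \<inter> form_orth T" by (simp add: form_orth_def)
next
  fix z assume "z \<in> form_orth S \<inter> form_orth T"
  then have "split_form (x + y) z = 0" if "x \<in> S" "y \<in> T" for x y
    using that by (simp add: form_orth_def split_form_linear)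
  then show "z \<in> form_orth {x + y |x y. x \<in> S \<and> y \<in> T}" unfolding form_orth_def by blast
qed

lemma form_orth_parts: "form_orth anti_part = inv_part" "form_orth inv_part = anti_part"
proof -
  show "form_orth anti_part = inv_part"
  proof (intro equalityI subsetI)
    fix x assume "x \<in> form_orth anti_part"
    then have "split_form (0, fst (snd x), 0) x = 0" unfolding form_orth_def anti_part_def by auto
    then show "x \<in> inv_part" by (simp add: split_form_def inv_part_def)
  qed (auto simp: form_orth_def part_defs split_form_def)
  show "form_orth inv_part = anti_part"
  proof (intro equalityI subsetI)
    fix x assume "x \<in> form_orth inv_part"
    then have "split_form (fst x, 0, 0) x = 0" "split_form (0, 0, snd (snd x)) x = 0"
      unfolding form_orth_def inv_part_def by auto
    then show "x \<in> anti_part" by (simp add: split_form_def anti_part_def)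
  qed (auto simp: form_orth_def part_defs split_form_def)
qed

text \<open>
  The reversed Cauchy--Schwarz inequality: a vector orthogonal to a null vector cannot lie inside
  the light cone.
\<close>

lemma light_cone:
  fixes x y :: "real \<times> 'w::euclidean_space \<times> 'm::euclidean_space"
  assumes "x \<in> inv_part" "y \<in> inv_part" "y \<noteq> 0" "split_form y y = 0" "split_form y x = 0"
  shows "split_form x x \<le> 0"
proof -
  obtain t m s l where x: "x = (t, 0, m)" and y: "y = (s, 0, l)"
    using assms(1,2) by (auto simp: inv_part_def) (metis prod.collapse)
  have sl: "s\<^sup>2 = l \<bullet> l" using assms(4) by (simp add: y split_form_def power2_eq_square)
  have tm: "s * t = l \<bullet> m" using assms(5) by (simp add: x y split_form_def)
  have s: "s \<noteq> 0" using sl assms(3) by (auto simp: y zero_prod_def)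
  have "s\<^sup>2 * t\<^sup>2 \<le> s\<^sup>2 * (m \<bullet> m)"
    using Cauchy_Schwarz_ineq[of l m] by (simp add: sl power_mult_distrib flip: tm)
  then have "t\<^sup>2 \<le> m \<bullet> m" using s by simp
  then show ?thesis by (simp add: x split_form_def power2_eq_square)
qed

locale isotropic_subspace =
  fixes B :: "(real \<times> 'w::euclidean_space \<times> 'm::euclidean_space) set"
  assumes dims: "DIM('m) = 1 + DIM('w)"
    and subspace_B: "subspace B"
    and isotropic: "B \<subseteq> form_orth B"
begin

abbreviation "Z \<equiv> form_orth B"

lemmas subspaces = subspace_parts subspace_B subspace_form_orth subspace_inter subspace_sums

lemma isotropicD: "x \<in> B \<Longrightarrow> y \<in> B \<Longrightarrow> split_form x y = 0"
  using isotropic by (auto simp: form_orth_def)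

lemma B_disjoint_anti_part: "B \<inter> anti_part \<subseteq> {0}"
  using isotropicD by (fastforce simp: anti_part_def split_form_def prod_eq_iff)

lemma dim_Z: "dim Z + dim B = 2 * DIM('m)"
  using dim_form_orth[OF subspace_B] dims by simp

text \<open>
  Why \<open>B\<^sup>\<bottom> / B\<close> has no definite subspace of dimension larger than \<open>DIM('m) - dim B\<close>: on \<open>S + B\<close> the
  form takes the values that it takes on \<open>S\<close>, so \<open>S + B\<close> is semidefinite and meets a half-dimensional
  subspace of the opposite sign only in \<open>0\<close>.
  The scalar \<open>c\<close>, used with the values \<open>1\<close> and \<open>-1\<close>, treats both indices at once.
\<close>

lemma definite_dim_le:
  fixes S T :: "(real \<times> 'w \<times> 'm) set" and c :: real
  assumes S: "subspace S" "S \<subseteq> Z" and T: "subspace T" "dim T = DIM('m)"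
    and s: "\<And>x. x \<in> S \<Longrightarrow> x \<noteq> 0 \<Longrightarrow> c * split_form x x > 0"
    and t: "\<And>x. x \<in> T \<Longrightarrow> x \<noteq> 0 \<Longrightarrow> c * split_form x x < 0"
  shows "dim S + dim B \<le> DIM('m)"
proof -
  let ?S = "{x + y |x y. x \<in> S \<and> y \<in> B}"
  have "x = 0" if "x \<in> S" "x \<in> B" for x
    using s[OF that(1)] isotropicD[OF that(2,2)] by fastforce
  then have SB: "S \<inter> B \<subseteq> {0}" by blast
  have "?S \<inter> T \<subseteq> {0}"
  proof
    fix z assume z: "z \<in> ?S \<inter> T"
    then obtain x y where xy: "x \<in> S" "y \<in> B" "z = x + y" by auto
    have 0: "split_form y x = 0" using S(2) xy by (auto simp: form_orth_def)
    have "split_form z z = split_form x x"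
      using 0 isotropicD[OF xy(2) xy(2)]
      by (simp add: xy split_form_linear split_form_commute[of x y])
    then have "z = 0" if "x \<noteq> 0" using s[OF xy(1) that] t[of z] z by force
    moreover have "z = 0" if "x = 0"
      using that t[of z] z isotropicD[OF xy(2) xy(2)] by (auto simp: xy)
    ultimately show "z \<in> {0}" by auto
  qed
  then have "dim ?S + dim T \<le> dim (UNIV :: (real \<times> 'w \<times> 'm) set)"
    by (intro dim_add_le_disjoint subspaces S T) auto
  then show ?thesis using dim_sums_disjoint[OF S(1) subspace_B SB] T(2) dims by simp
qed

lemma pos_part_pos: "x \<in> pos_part \<Longrightarrow> x \<noteq> 0 \<Longrightarrow> split_form x x > 0"
  by (cases x) (auto simp: pos_part_def split_form_def zero_prod_def
      intro: add_pos_nonneg add_nonneg_pos simp flip: power2_eq_square)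

lemma neg_part_neg: "x \<in> neg_part \<Longrightarrow> x \<noteq> 0 \<Longrightarrow> split_form x x < 0"
  by (cases x) (auto simp: neg_part_def split_form_def zero_prod_def)

lemma dim_pos_in_Z: 
  assumes "subspace S" "S \<subseteq> Z" "\<And>x. x \<in> S \<Longrightarrow> x \<noteq> 0 \<Longrightarrow> split_form x x > 0"
  shows "dim S + dim B \<le> DIM('m)"
  by (rule definite_dim_le[OF assms(1,2) subspaces(3), of 1])
    (use assms(3) neg_part_neg in \<open>auto simp: dim_parts\<close>)

lemma dim_neg_in_Z: 
  assumes "subspace S" "S \<subseteq> Z" "\<And>x. x \<in> S \<Longrightarrow> x \<noteq> 0 \<Longrightarrow> split_form x x < 0"
  shows "dim S + dim B \<le> DIM('m)"
  by (rule definite_dim_le[OF assms(1,2) subspaces(4), of "-1"])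
    (use assms(3) pos_part_pos dims in \<open>auto simp: dim_parts\<close>)

lemma dim_Z_pos_part: "dim (Z \<inter> pos_part) + dim B = DIM('m)"
proof (rule antisym)
  show "dim (Z \<inter> pos_part) + dim B \<le> DIM('m)"
    by (intro dim_pos_in_Z subspaces) (use pos_part_pos in auto)
  show "DIM('m) \<le> dim (Z \<inter> pos_part) + dim B"
    using dim_Int_lower[OF subspace_form_orth subspace_parts(4) subspace_UNIV, of B] dim_Z dims
    by (simp add: dim_parts)
qed

lemma dim_Z_neg_part: "dim (Z \<inter> neg_part) + dim B = DIM('m)"
proof (rule antisym)
  show "dim (Z \<inter> neg_part) + dim B \<le> DIM('m)"
    by (intro dim_neg_in_Z subspaces) (use neg_part_neg in auto)
  show "DIM('m) \<le> dim (Z \<inter> neg_part) + dim B"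
    using dim_Int_lower[OF subspace_form_orth subspace_parts(3) subspace_UNIV, of B] dim_Z dims
    by (simp add: dim_parts)
qed

lemma pos_dim_Z: "pos_dim split_form Z = DIM('m) - dim B"
proof (rule pos_dim_eqI[of "Z \<inter> pos_part"])
  show "subspace (Z \<inter> pos_part)" by (intro subspaces)
qed (use dim_Z_pos_part dim_pos_in_Z pos_part_pos in \<open>force simp: le_diff_conv2\<close>)+

lemma neg_dim_Z_inv_part: "pos_dim (\<lambda>x y. - split_form x y) (Z \<inter> inv_part) = DIM('m) - dim B"
proof (rule pos_dim_eqI[of "Z \<inter> neg_part"])
  show "subspace (Z \<inter> neg_part)" by (intro subspaces)
  show "Z \<inter> neg_part \<subseteq> Z \<inter> inv_part" by (auto simp: part_defs)
qed (use dim_Z_neg_part dim_neg_in_Z neg_part_neg in \<open>force simp: le_diff_conv2\<close>)+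

text \<open>
  The intersections of \<open>Z\<close> with both parts are orthogonal complements themselves, of
  \<open>B + anti_part\<close> and \<open>B + inv_part\<close>. The first sum is direct because \<open>anti_part\<close> is definite; the second one need not be.
\<close>

lemma dim_Z_inv_part: "dim (Z \<inter> inv_part) + dim B = 1 + DIM('m)"
  using dim_form_orth[OF subspace_sums[OF subspace_B subspace_parts(2)]]
    dim_sums_disjoint[OF subspace_B subspace_parts(2) B_disjoint_anti_part] dims
  unfolding form_orth_sums[OF subspace_B subspace_parts(2)] form_orth_parts dim_parts by linarith

lemma dim_Z_anti_part:
  "dim (Z \<inter> anti_part) + dim B + 1 = DIM('m) + dim (B \<inter> inv_part)"
  using dim_form_orth[OF subspace_sums[OF subspace_B subspace_parts(1)]]
    dim_sums_Int[OF subspace_B subspace_parts(1)] dims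
  unfolding form_orth_sums[OF subspace_B subspace_parts(1)] form_orth_parts dim_parts by linarith

lemma inv_part_disjoint_iff: "B \<inter> inv_part = {0} \<longleftrightarrow> dim (B \<inter> inv_part) = 0"
  using subspace_0[OF subspace_B] subspace_0[OF subspace_parts(1)] by (auto simp: dim_eq_0)

text \<open>
  A common nonzero element of \<open>B\<close> and the invariant part is a null vector. Every element of \<open>Z\<close>, hence
  also its invariant component, is orthogonal to it.
\<close>

lemma inv_projection_not_pos_if_meets:
  fixes x :: "real \<times> 'w \<times> 'm"
  assumes "B \<inter> inv_part \<noteq> {0}" "x \<in> Z" "split_form (fst x, 0 :: 'w, snd (snd x)) (fst x, 0, snd (snd x)) > 0"
  shows False
proof -
  obtain y where y: "y \<in> B" "y \<in> inv_part" "y \<noteq> 0" 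
    using assms(1) subspace_0[OF subspace_B] subspace_0[OF subspace_parts(1)] by blast
  have "split_form y x = 0" using assms(2) y by (auto simp: form_orth_def)
  then have "split_form y (fst x, 0, snd (snd x)) = 0"
    using y(2) by (auto simp: split_form_def inv_part_def)
  from light_cone[OF _ y(2,3) isotropicD[OF y(1,1)] this]
  show False using assms(3) by (simp add: inv_part_def)
qed

text \<open>
  The dimension formula turns \<open>B \<inter> inv_part = 0\<close> into \<open>Z + anti_part = UNIV\<close>.
\<close>

lemma exists_closed_lift:
  fixes p :: "real \<times> 'w \<times> 'm"
  assumes "B \<inter> inv_part = {0}" "p \<in> inv_part"
  obtains w where "(fst p, w, snd (snd p)) \<in> Z"
proof -
  have "dim (Z \<inter> anti_part) + dim B + 1 = DIM('m)" using dim_Z_anti_part assms(1) by simp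
  then have "dim {x + y |x y. x \<in> Z \<and> y \<in> anti_part} = 2 * DIM('m)"
    using dim_sums_Int[OF subspace_form_orth subspace_parts(2), of B] dim_Z dims by (simp add: dim_parts)
  then have "span {x + y |x y. x \<in> Z \<and> y \<in> anti_part} = UNIV"
    unfolding dim_eq_full[symmetric] using dims by simp
  then have "p \<in> {x + y |x y. x \<in> Z \<and> y \<in> anti_part}"
    unfolding span_eq_iff[THEN iffD2, OF subspace_sums[OF subspace_form_orth subspace_parts(2)]] by blast
  then obtain x y where xy: "x \<in> Z" "y \<in> anti_part" "p = x + y" by blast
  then have "x = (fst p, - fst (snd y), snd (snd p))"
    using assms(2) by (auto simp: part_defs prod_eq_iff eq_neg_iff_add_eq_0)
  then show ?thesis using xy that by metis
qed

text \<open>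
  At most one positive direction exists because the invariant part is Lorentzian. If \<open>B\<close> does not meet
  it, a positive vector arises by intersecting, inside \<open>Z\<close>, the space \<open>(Z \<inter> inv_part) + B\<close> with a
  maximal positive definite subspace: their dimensions add up to one more than \<open>dim Z\<close>, and the
  summand in \<open>B\<close> does not contribute to the square.
\<close>

lemma pos_dim_Z_inv_part:
  "pos_dim split_form (Z \<inter> inv_part) = (if B \<inter> inv_part = {0} then 1 else 0)"
proof (cases "B \<inter> inv_part = {0}")
  case True
  let ?S = "{x + y |x y. x \<in> Z \<inter> inv_part \<and> y \<in> B}"
  have "dim ?S = 1 + DIM('m)"
    using dim_sums_disjoint[of "Z \<inter> inv_part" B] True dim_Z_inv_part subspaces by auto
  moreover have "?S \<subseteq> Z" using isotropic subspace_add[OF subspace_form_orth] by blast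
  moreover have "Z \<inter> pos_part \<subseteq> Z" by blast
  moreover have "subspace ?S" "subspace (Z \<inter> pos_part)" by (intro subspaces)+
  ultimately have "dim (?S \<inter> (Z \<inter> pos_part)) \<noteq> 0"
    using dim_Int_lower[of ?S "Z \<inter> pos_part" Z] dim_Z dim_Z_pos_part subspace_form_orth[of B] by linarith
  then obtain z where z: "z \<in> ?S" "z \<in> pos_part" "z \<noteq> 0" unfolding dim_eq_0 by blast
  then obtain x y where xy: "x \<in> Z \<inter> inv_part" "y \<in> B" "z = x + y" by blast
  have "split_form y x = 0" using xy by (auto simp: form_orth_def)
  then have "split_form z z = split_form x x"
    using isotropicD[OF xy(2,2)] by (simp add: xy split_form_linear split_form_commute[of x y])
  then have x: "split_form x x > 0" using pos_part_pos[OF z(2,3)] by simp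
  then have x0: "x \<noteq> 0" by (auto simp: split_form_linear)
  have "pos_dim split_form (Z \<inter> inv_part) = 1"
  proof (rule pos_dim_eqI[of "span {x}"])
    show "span {x} \<subseteq> Z \<inter> inv_part" using xy by (intro span_minimal subspaces) auto
    show "0 < split_form v v" if v: "v \<in> span {x}" "v \<noteq> 0" for v
    proof -
      obtain c where "v = c *\<^sub>R x" using v(1) by (auto simp: span_singleton)
      then show ?thesis using v(2) x
        by (auto simp: split_form_linear zero_less_mult_iff mult.assoc[symmetric])
    qed
    show "dim (span {x}) = 1" using x0 by (simp add: dim_eq_card_independent)
  next
    fix S :: "(real \<times> 'w \<times> 'm) set"
    assume S: "subspace S" "S \<subseteq> Z \<inter> inv_part" "\<And>x. x \<in> S \<Longrightarrow> x \<noteq> 0 \<Longrightarrow> 0 < split_form x x"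
    have "S \<inter> neg_part \<subseteq> {0}" using S(3) neg_part_neg by force
    then have "dim S + dim (neg_part :: (real \<times> 'w \<times> 'm) set) \<le> dim (inv_part :: (real \<times> 'w \<times> 'm) set)"
      using S(2) by (intro dim_add_le_disjoint subspaces S(1)) (auto simp: part_defs)
    then show "dim S \<le> 1" by (simp add: dim_parts)
  qed simp
  then show ?thesis using True by simp
next
  case False
  have "pos_dim split_form (Z \<inter> inv_part) = 0"
  proof (rule pos_dim_eqI[of "{0}"])
    fix S :: "(real \<times> 'w \<times> 'm) set"
    assume S: "subspace S" "S \<subseteq> Z \<inter> inv_part" "\<And>x. x \<in> S \<Longrightarrow> x \<noteq> 0 \<Longrightarrow> 0 < split_form x x"
    have "x = 0" if "x \<in> S" for x
    proof (rule ccontr)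
      assume "x \<noteq> 0"
      moreover have "x = (fst x, 0, snd (snd x))" using S(2) that by (auto simp: inv_part_def prod_eq_iff)
      ultimately show False using inv_projection_not_pos_if_meets[OF False, of x] S that by (metis IntD1 subsetD)
    qed
    then have "S \<subseteq> {0}" by auto
    then show "dim S \<le> 0" by (simp add: dim_eq_0[THEN iffD2])
  next
    show "subspace {0 :: real \<times> 'w \<times> 'm}" by (rule subspace_single_0)
  next
    show "{0} \<subseteq> Z \<inter> inv_part"
      using subspace_0[OF subspace_form_orth] subspace_0[OF subspace_parts(1)] by blast
  qed (auto simp: subspace_0)
  then show ?thesis using False by simp
qed

end

section \<open>Dimensions and indices in presented vector spaces\<close>

text \<open>
  The dimension of a carrier-based vector space \<open>M\<close> is computed in a Euclidean space \<open>'e\<close> by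
  presenting \<open>M\<close> as the image of a subspace \<open>Z\<close> under a map that is linear on \<open>Z\<close>. Cohomology is
  presented in this way by the coordinates of closed forms.
\<close>

locale linear_presentation =
  fixes M :: "(real, 'v) module" and Z :: "'e::euclidean_space set" and f :: "'e \<Rightarrow> 'v"
  assumes vectorspace_M: "vectorspace class_ring M"
    and subspace_Z: "subspace Z"
    and map_add: "\<And>x y. x \<in> Z \<Longrightarrow> y \<in> Z \<Longrightarrow> f (x + y) = f x \<oplus>\<^bsub>M\<^esub> f y"
    and map_scale: "\<And>c x. x \<in> Z \<Longrightarrow> f (c *\<^sub>R x) = c \<odot>\<^bsub>M\<^esub> f x"
    and surj: "f ` Z = carrier M"
begin

interpretation M: vectorspace class_ring M by (rule vectorspace_M)

definition "K = {x \<in> Z. f x = \<zero>\<^bsub>M\<^esub>}"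

lemma map_closed: "x \<in> Z \<Longrightarrow> f x \<in> carrier M" using surj by blast

lemma map_zero: "f 0 = \<zero>\<^bsub>M\<^esub>"
  using map_scale[OF subspace_0[OF subspace_Z], of 0] map_closed[OF subspace_0[OF subspace_Z]]
    M.lmult_0 by simp

lemma subspace_K: "subspace K"
proof (rule subspaceI)
  show "0 \<in> K" by (simp add: K_def map_zero subspace_0[OF subspace_Z])
  show "x + y \<in> K" if "x \<in> K" "y \<in> K" for x y
    using that subspace_add[OF subspace_Z] by (simp add: K_def map_add)
  show "c *\<^sub>R x \<in> K" if "x \<in> K" for c x
    using that subspace_scale[OF subspace_Z] M.smult_r_null[of c] by (simp add: K_def map_scale)
qed

lemma map_eqD: 
  assumes "x \<in> Z" "y \<in> Z" "f x = f y" shows "x - y \<in> K"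
proof -
  have "x - y \<in> Z" using assms subspace_diff[OF subspace_Z] by blast
  moreover have "f (x - y) \<oplus>\<^bsub>M\<^esub> f y = \<zero>\<^bsub>M\<^esub> \<oplus>\<^bsub>M\<^esub> f y"
    using map_add[OF \<open>x - y \<in> Z\<close> assms(2)] assms map_closed by simp
  ultimately have "f (x - y) = \<zero>\<^bsub>M\<^esub>"
    using M.add.right_cancel[OF map_closed[OF assms(2)] map_closed[OF \<open>x - y \<in> Z\<close>] M.zero_closed]
    by simp
  then show ?thesis using \<open>x - y \<in> Z\<close> by (simp add: K_def)
qed

lemma image_subspace:
  assumes "subspace S" "S \<subseteq> Z"
  shows "real_subspace (f ` S) M"
  unfolding VectorSpace.subspace_def submodule_def
proof (intro conjI allI impI vectorspace_M)
  show "Module.module class_ring M" by (rule M.module_axioms)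
  show "f ` S \<subseteq> carrier M" using assms(2) map_closed by auto
  show "\<zero>\<^bsub>M\<^esub> \<in> f ` S" using map_zero subspace_0[OF assms(1)] by force
next
  fix v w assume "v \<in> f ` S" "w \<in> f ` S"
  then obtain x y where "x \<in> S" "y \<in> S" "v = f x" "w = f y" by blast
  then show "v \<oplus>\<^bsub>M\<^esub> w \<in> f ` S"
    using map_add[of x y] subspace_add[OF assms(1)] assms(2) by (metis image_eqI subsetD)
next
  fix c v assume "v \<in> f ` S"
  then obtain x where "x \<in> S" "v = f x" by blast
  then show "c \<odot>\<^bsub>M\<^esub> v \<in> f ` S"
    using map_scale[of x c] subspace_scale[OF assms(1)] assms(2) by (metis image_eqI subsetD)
qed

lemma dim_image_inj:
  assumes S: "subspace S" "S \<subseteq> Z" and K: "S \<inter> K \<subseteq> {0}"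
  shows "subspace_dim M (f ` S) = dim S"
proof -
  let ?W = "M\<lparr>carrier := f ` S\<rparr>"
  interpret W: vectorspace class_ring ?W by (rule M.subspace_is_vs[OF image_subspace[OF S]])
  have inj: "x = y" if "x \<in> S" "y \<in> S" "f x = f y" for x y
  proof -
    have "x - y \<in> S \<inter> K" using map_eqD[of x y] that S subspace_diff[OF S(1), of x y] by blast
    then show ?thesis using K by auto
  qed
  obtain C where C: "C \<subseteq> S" "independent C" "S \<subseteq> span C" "card C = dim S"
    using basis_exists by metis
  have fin: "finite C" using C(2) independent_imp_finite by blast
  have injC: "inj_on f C" using inj C(1) by (auto intro: inj_onI)
  have sumS: "(\<Sum>c\<in>D. a c *\<^sub>R c) \<in> S" if "D \<subseteq> C" for a D
    using that C(1) by (intro subspace_sum[OF S(1)] subspace_scale[OF S(1)]) auto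
  have cl: "a \<odot>\<^bsub>M\<^esub> f x = f (a *\<^sub>R x)" "a *\<^sub>R x \<in> S" if "x \<in> C" for a x
    using that C(1) S(2) map_scale subspace_scale[OF S(1)] by auto
  have sum: "finsum ?W (\<lambda>c. a c \<odot>\<^bsub>M\<^esub> f c) D = f (\<Sum>c\<in>D. a c *\<^sub>R c)" if "D \<subseteq> C" for a D
    using finite_subset[OF that fin] that
  proof (induction D rule: finite_induct)
    case empty then show ?case using map_zero by simp
  next
    case (insert c D)
    have "finsum ?W (\<lambda>c. a c \<odot>\<^bsub>M\<^esub> f c) (insert c D)
      = f (a c *\<^sub>R c) \<oplus>\<^bsub>M\<^esub> f (\<Sum>c\<in>D. a c *\<^sub>R c)"
      using insert cl by (subst W.finsum_insert) auto
    also have "\<dots> = f (a c *\<^sub>R c + (\<Sum>c\<in>D. a c *\<^sub>R c))"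
      by (rule map_add[symmetric]) (use cl[of c "a c"] sumS[of D a] insert.prems S(2) in auto)
    finally show ?case using insert by simp
  qed
  have lincomb: "W.lincomb a (f ` C) = f (\<Sum>c\<in>C. a (f c) *\<^sub>R c)" for a
  proof -
    have "W.lincomb a (f ` C) = finsum ?W (\<lambda>c. a (f c) \<odot>\<^bsub>M\<^esub> f c) C"
      unfolding W.lincomb_def
      using cl injC by (subst W.add.finprod_reindex) auto
    then show ?thesis using sum[of C "\<lambda>c. a (f c)"] by simp
  qed
  have sub: "f ` C \<subseteq> carrier ?W" using C(1) by auto
  have "W.lin_indpt (f ` C)"
  proof (rule W.finite_lin_indpt2[OF finite_imageI[OF fin] sub])
    fix a assume "W.lincomb a (f ` C) = \<zero>\<^bsub>?W\<^esub>"
    then have "f (\<Sum>c\<in>C. a (f c) *\<^sub>R c) = f 0" by (simp add: lincomb map_zero)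
    then have "(\<Sum>c\<in>C. a (f c) *\<^sub>R c) = 0"
      using inj[OF sumS[OF order_refl] subspace_0[OF S(1)]] by simp
    then have "\<forall>c\<in>C. a (f c) = 0"
      using independentD[OF C(2) fin order_refl, of "\<lambda>c. a (f c)"] by blast
    then show "\<forall>v\<in>f ` C. a v = \<zero>\<^bsub>class_ring\<^esub>" by simp
  qed
  moreover have "W.gen_set (f ` C)"
  proof (intro equalityI)
    show "W.span (f ` C) \<subseteq> carrier ?W" using W.span_is_subset2[OF sub] .
    show "carrier ?W \<subseteq> W.span (f ` C)"
    proof
      fix v assume "v \<in> carrier ?W"
      then obtain x where x: "x \<in> S" "v = f x" by auto
      then obtain u where "x = (\<Sum>c\<in>C. u c *\<^sub>R c)"
        using C(3) span_finite[OF fin] by auto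
      then have "v = W.lincomb (u \<circ> inv_into C f) (f ` C)"
        unfolding lincomb x(2) by (intro arg_cong[of _ _ f] sum.cong) (auto simp: injC)
      then show "v \<in> W.span (f ` C)"
        unfolding W.finite_span[OF finite_imageI[OF fin] sub] by auto
    qed
  qed
  ultimately have "W.dim = card (f ` C)"
    using sub by (intro W.dim_basis finite_imageI fin) (simp add: W.basis_def)
  then show ?thesis using C(4) card_image[OF injC] by simp
qed

text \<open>
  The orthogonal complement of the kernel in \<open>S\<close> has the same image as \<open>S\<close>, and the map is injective
  on it; this reduces statements on images to the injective case.
\<close>

lemma complement_in_subspace:
  assumes "subspace S" "S \<subseteq> Z"
  obtains T where "subspace T" "T \<subseteq> S" "T \<inter> K \<subseteq> {0}" "f ` T = f ` S" "dim T + dim (S \<inter> K) = dim S"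
proof -
  have SK: "subspace (S \<inter> K)" using assms(1) subspace_K by (rule subspace_inter)
  let ?T = "{y \<in> S. \<forall>x \<in> S \<inter> K. Linear_Algebra.orthogonal x y}"
  show ?thesis
  proof (rule that[of ?T])
    show sT: "subspace ?T"
      using assms(1) by (auto simp: subspace_def Linear_Algebra.orthogonal_def inner_simps)
    show disj: "?T \<inter> K \<subseteq> {0}" unfolding Linear_Algebra.orthogonal_def
      by (blast intro: inner_eq_zero_iff[THEN iffD1])
    show d: "dim ?T + dim (S \<inter> K) = dim S"
      using dim_subspace_orthogonal_to_vectors[OF SK assms(1)] by auto
    show "f ` ?T = f ` S"
    proof (rule equalityI[OF image_mono subsetI])
      fix v assume "v \<in> f ` S"
      then obtain x where x: "x \<in> S" "v = f x" by blast
      obtain y z where yz: "y \<in> span (S \<inter> K)" "\<And>w. w \<in> span (S \<inter> K) \<Longrightarrow> Linear_Algebra.orthogonal z w" "x = y + z"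
        by (rule orthogonal_subspace_decomp_exists[of "S \<inter> K" x]) (rule that; blast)
      have y: "y \<in> S \<inter> K" using yz(1) span_eq_iff[THEN iffD2, OF SK] by simp
      have z: "z = x - y" using yz by simp
      have zS: "z \<in> S" unfolding z using x y subspace_diff[OF assms(1)] by blast
      then have "z \<in> ?T" using yz(2)[OF span_base] by (simp add: orthogonal_commute)
      moreover have "f z = v"
      proof -
        have "f x = f y \<oplus>\<^bsub>M\<^esub> f z" unfolding yz(3) using map_add y zS assms(2) by blast
        also have "\<dots> = f z" using y map_closed[of z] zS assms(2) by (simp add: K_def subset_iff)
        finally show ?thesis using x by simp
      qed
      ultimately show "v \<in> f ` ?T" by blast
    qed auto
  qed auto
qed

lemma dim_image:
  assumes "subspace S" "S \<subseteq> Z"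
  shows "subspace_dim M (f ` S) + dim (S \<inter> K) = dim S"
proof -
  obtain T where T: "subspace T" "T \<subseteq> S" "T \<inter> K \<subseteq> {0}" "f ` T = f ` S" "dim T + dim (S \<inter> K) = dim S"
    using complement_in_subspace[OF assms] .
  then show ?thesis using dim_image_inj[of T] assms(2) by auto
qed

lemma preimage_subspace:
  assumes "real_subspace U M" "subspace W" "W \<subseteq> Z"
  shows "subspace {x \<in> W. f x \<in> U}"
proof (rule subspaceI)
  have U: "submodule class_ring U M" using assms(1) by (simp add: VectorSpace.subspace_def)
  note U = submodule.m_closed[OF U] submodule.zero_closed[OF U] submodule.smult_closed[OF U]
  show "0 \<in> {x \<in> W. f x \<in> U}" by (simp add: map_zero U subspace_0[OF assms(2)])
  show "x + y \<in> {x \<in> W. f x \<in> U}" if "x \<in> {x \<in> W. f x \<in> U}" "y \<in> {x \<in> W. f x \<in> U}" for x y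
    using that U(1)[of "f x" "f y"] subspace_add[OF assms(2)] map_add[of x y] subsetD[OF assms(3)] by simp
  show "c *\<^sub>R x \<in> {x \<in> W. f x \<in> U}" if "x \<in> {x \<in> W. f x \<in> U}" for c x
    using that U(3)[of c "f x"] subspace_scale[OF assms(2)] map_scale[of x c] subsetD[OF assms(3)] by simp
qed

text \<open>
  A definite subspace upstairs meets the kernel only in \<open>0\<close>, as \<open>q\<close> is not positive there, so its
  image has the same dimension. A definite subspace downstairs lifts, with its dimension, to a
  complement of the kernel in its preimage. So both maxima range over the same set of numbers.
\<close>

lemma pos_index_image:
  assumes W: "subspace W" "W \<subseteq> Z"
    and p: "\<And>x y. x \<in> Z \<Longrightarrow> y \<in> Z \<Longrightarrow> p (f x) (f y) = q x y"
    and q: "\<And>x. x \<in> K \<Longrightarrow> \<not> q x x > 0"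
  shows "pos_index M p (f ` W) = pos_dim q W"
proof -
  have "{subspace_dim M U | U. real_subspace U M \<and> U \<subseteq> f ` W \<and> (\<forall>x\<in>U. x \<noteq> \<zero>\<^bsub>M\<^esub> \<longrightarrow> p x x > 0)} =
    {dim S | S. subspace S \<and> S \<subseteq> W \<and> (\<forall>x\<in>S. x \<noteq> 0 \<longrightarrow> q x x > 0)}"
  proof (intro equalityI subsetI; clarify)
    fix U assume U: "real_subspace U M" "U \<subseteq> f ` W" "\<forall>x\<in>U. x \<noteq> \<zero>\<^bsub>M\<^esub> \<longrightarrow> p x x > 0"
    let ?S = "{x \<in> W. f x \<in> U}"
    have "subspace ?S" "?S \<subseteq> Z" using preimage_subspace[OF U(1) W] W by auto
    then obtain T where T: "subspace T" "T \<subseteq> ?S" "T \<inter> K \<subseteq> {0}" "f ` T = f ` ?S"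
      by (rule complement_in_subspace)
    have fS: "f ` ?S = U" using U(2) by auto
    have TZ: "T \<subseteq> Z" using T(2) W by auto
    have "q x x > 0" if "x \<in> T" "x \<noteq> 0" for x
    proof -
      have "f x \<noteq> \<zero>\<^bsub>M\<^esub>" using that T TZ by (auto simp: K_def)
      moreover have "f x \<in> U" "x \<in> Z" using that(1) T(2) TZ by auto
      ultimately have "p (f x) (f x) > 0" using U(3) by blast
      then show ?thesis using p[of x x] \<open>x \<in> Z\<close> by simp
    qed
    moreover have "subspace_dim M U = dim T" using dim_image_inj[OF T(1) TZ T(3)] T(4) fS by simp
    ultimately show "\<exists>S. subspace_dim M U = dim S \<and> subspace S \<and> S \<subseteq> W \<and> (\<forall>x\<in>S. x \<noteq> 0 \<longrightarrow> q x x > 0)"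
      using T by blast
  next
    fix S assume S: "subspace S" "S \<subseteq> W" "\<forall>x\<in>S. x \<noteq> 0 \<longrightarrow> q x x > 0"
    have SZ: "S \<subseteq> Z" using S(2) W by auto
    have "S \<inter> K \<subseteq> {0}" using S(3) q by auto
    then have "subspace_dim M (f ` S) = dim S" by (rule dim_image_inj[OF S(1) SZ])
    moreover have "p v v > 0" if v: "v \<in> f ` S" "v \<noteq> \<zero>\<^bsub>M\<^esub>" for v
    proof -
      obtain x where x: "x \<in> S" "v = f x" using v by blast
      then have "x \<noteq> 0" using v map_zero by auto
      then show ?thesis using S(3) x p[of x x] SZ by auto
    qed
    ultimately show "\<exists>U. dim S = subspace_dim M U \<and> real_subspace U M \<and> U \<subseteq> f ` W \<and> (\<forall>x\<in>U. x \<noteq> \<zero>\<^bsub>M\<^esub> \<longrightarrow> p x x > 0)"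
      using image_subspace[OF S(1) SZ] S(2) by (intro exI[of _ "f ` S"]) auto
  qed
  then show ?thesis unfolding pos_index_def pos_dim_def by simp
qed

end

section \<open>Two-forms in a complex frame\<close>

text \<open>
  The definition of the trace uses some unspecified basis. Expanding each of the two bases in the
  other one shows that every finite basis gives the same value.
\<close>

lemma linear_trace_basis:
  fixes f :: "'a::real_vector \<Rightarrow> 'a"
  assumes f: "linear f" and C: "independent C" "span C = UNIV" "finite C"
  shows "linear_trace f = (\<Sum>c\<in>C. representation C (f c) c)"
proof -
  define B where "B = extend_basis ({} :: 'a set)"
  have B: "independent B" "span B = UNIV"
    unfolding B_def by (rule independent_extend_basis[OF independent_empty] span_extend_basis[OF independent_empty])+
  have fB: "finite B" using independent_span_bound[OF C(3) B(1)] C(2) by simp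
  have "(\<Sum>b\<in>B. representation B (f b) b) = (\<Sum>b\<in>B. \<Sum>c\<in>C. representation C (f b) c * representation B c b)"
  proof (rule sum.cong[OF refl])
    fix b assume "b \<in> B"
    have "f b = (\<Sum>c\<in>C. representation C (f b) c *\<^sub>R c)"
      using sum_representation_eq[OF C(1), of "f b" C] C by simp
    then have "representation B (f b) b = representation B (\<Sum>c\<in>C. representation C (f b) c *\<^sub>R c) b"
      by (rule arg_cong)
    also have "\<dots> = (\<Sum>c\<in>C. representation C (f b) c * representation B c b)"
      using B by (simp add: representation_sum representation_scale)
    finally show "representation B (f b) b = \<dots>" .
  qed
  also have "\<dots> = (\<Sum>c\<in>C. \<Sum>b\<in>B. representation B c b * representation C (f b) c)"
    by (subst sum.swap) (simp add: mult.commute)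
  also have "\<dots> = (\<Sum>c\<in>C. representation C (f c) c)"
  proof (rule sum.cong[OF refl])
    fix c assume "c \<in> C"
    have "c = (\<Sum>b\<in>B. representation B c b *\<^sub>R b)"
      using sum_representation_eq[OF B(1), of c B] B fB by simp
    then have "f c = f (\<Sum>b\<in>B. representation B c b *\<^sub>R b)" by (rule arg_cong)
    also have "\<dots> = (\<Sum>b\<in>B. representation B c b *\<^sub>R f b)"
      by (simp only: linear_sum[OF f] linear_scale[OF f])
    finally have "f c = (\<Sum>b\<in>B. representation B c b *\<^sub>R f b)" .
    then show "(\<Sum>b\<in>B. representation B c b * representation C (f b) c) = representation C (f c) c"
      using C by (simp add: representation_sum representation_scale)
  qed
  finally show ?thesis by (simp add: linear_trace_def B_def)
qed

lemma Forms2D: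
  assumes "\<alpha> \<in> Forms2"
  shows "\<alpha> (u + u') v = \<alpha> u v + \<alpha> u' v" "\<alpha> u (v + v') = \<alpha> u v + \<alpha> u v'"
    "\<alpha> (c *\<^sub>R u) v = c * \<alpha> u v" "\<alpha> u (c *\<^sub>R v) = c * \<alpha> u v"
    "\<alpha> (- u) v = - \<alpha> u v" "\<alpha> u (- v) = - \<alpha> u v" "\<alpha> u u = 0"
  using assms by (auto simp: Forms2_def bilinear_ladd bilinear_radd bilinear_lmul bilinear_rmul
      bilinear_lneg bilinear_rneg)

lemma Forms2_0: "\<alpha> \<in> Forms2 \<Longrightarrow> \<alpha> 0 v = 0" "\<alpha> \<in> Forms2 \<Longrightarrow> \<alpha> u 0 = 0"
  by (auto simp: Forms2_def bilinear_lzero bilinear_rzero)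

lemma Forms2_anti: "\<alpha> \<in> Forms2 \<Longrightarrow> \<alpha> u v = - \<alpha> v u"
  using Forms2D(7)[of \<alpha> "u + v"] by (simp add: Forms2D)

lemma wedge22_Forms4:
  assumes "\<alpha> \<in> Forms2" "\<beta> \<in> Forms2"
  shows "wedge22 \<alpha> \<beta> \<in> Forms4"
  unfolding Forms4_def mem_Collect_eq
proof (intro conjI allI)
  note D = Forms2D[OF assms(1)] Forms2D[OF assms(2)]
  fix a b c d
  show "linear (\<lambda>a. wedge22 \<alpha> \<beta> a b c d)" "linear (\<lambda>b. wedge22 \<alpha> \<beta> a b c d)"
    "linear (\<lambda>c. wedge22 \<alpha> \<beta> a b c d)" "linear (\<lambda>d. wedge22 \<alpha> \<beta> a b c d)"
    unfolding linear_iff wedge22_def D by (simp_all add: algebra_simps)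
next
  note D = Forms2D[OF assms(1)] Forms2D[OF assms(2)]
  fix u v w
  have anti: "\<alpha> v u = - \<alpha> u v" "\<alpha> w u = - \<alpha> u w" "\<beta> v u = - \<beta> u v" "\<beta> w u = - \<beta> u w"
    using Forms2_anti assms by blast+
  show "wedge22 \<alpha> \<beta> u u v w = 0" "wedge22 \<alpha> \<beta> u v u w = 0" "wedge22 \<alpha> \<beta> u v w u = 0"
    "wedge22 \<alpha> \<beta> v u u w = 0" "wedge22 \<alpha> \<beta> v u w u = 0" "wedge22 \<alpha> \<beta> v w u u = 0"
    unfolding wedge22_def D anti by (simp_all add: algebra_simps)
qed

lemma bracket_anti:
  assumes "lie_bracket br" shows "br v u = - br u v"
proof -
  have b: "bilinear br" and z: "\<And>u. br u u = 0" using assms by (auto simp: lie_bracket_def)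
  show ?thesis using z[of "u + v"] z[of u] z[of v] b
    by (simp add: bilinear_ladd bilinear_radd eq_neg_iff_add_eq_0 add.commute)
qed

type_synonym coords2 = "real \<times> (real \<times> real) \<times> (real \<times> real \<times> real)"

locale complex_frame =
  fixes J :: "'a::real_vector \<Rightarrow> 'a" and e f :: 'a
  assumes J: "almost_complex J"
    and distinct: "distinct [e, J e, f, J f]"
    and indep: "independent {e, J e, f, J f}"
    and span: "span {e, J e, f, J f} = UNIV"
begin

abbreviation "frame \<equiv> {e, J e, f, J f}"

definition "x1 v = representation frame v e"
definition "x2 v = representation frame v (J e)"
definition "x3 v = representation frame v f"
definition "x4 v = representation frame v (J f)"

lemmas x_defs = x1_def x2_def x3_def x4_def

lemma neqs: "e \<noteq> J e" "e \<noteq> f" "e \<noteq> J f" "J e \<noteq> f" "J e \<noteq> J f" "f \<noteq> J f"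
  using distinct by auto

lemma J_simps: "J (u + v) = J u + J v" "J (c *\<^sub>R u) = c *\<^sub>R J u" "J (J u) = - u"
  using J by (auto simp: almost_complex_def linear_add linear_scale)

lemma linear_x: "linear x1" "linear x2" "linear x3" "linear x4"
  by (auto simp: linear_iff x_defs representation_add[OF indep] representation_scale[OF indep] span)

lemmas x_linear [simp] = linear_x[THEN linear_add] linear_x[THEN linear_scale] linear_x[THEN linear_neg]
  linear_x[THEN linear_diff]   linear_x[THEN linear_0]

lemma x_frame [simp]:
  "x1 e = 1" "x1 (J e) = 0" "x1 f = 0" "x1 (J f) = 0"
  "x2 e = 0" "x2 (J e) = 1" "x2 f = 0" "x2 (J f) = 0"
  "x3 e = 0" "x3 (J e) = 0" "x3 f = 1" "x3 (J f) = 0"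
  "x4 e = 0" "x4 (J e) = 0" "x4 f = 0" "x4 (J f) = 1"
  using neqs by (simp_all add: x_defs representation_basis[OF indep])

lemma expand: "v = x1 v *\<^sub>R e + x2 v *\<^sub>R J e + x3 v *\<^sub>R f + x4 v *\<^sub>R J f"
proof -
  have "(\<Sum>b\<in>frame. representation frame v b *\<^sub>R b) = v"
    by (rule sum_representation_eq[OF indep]) (simp_all add: span)
  then show ?thesis using neqs by (simp add: x_defs add.assoc)
qed

lemma x_J [simp]: "x1 (J v) = - x2 v" "x2 (J v) = x1 v" "x3 (J v) = - x4 v" "x4 (J v) = x3 v"
proof -
  have "J v = x1 v *\<^sub>R J e - x2 v *\<^sub>R e + x3 v *\<^sub>R J f - x4 v *\<^sub>R f"
    using arg_cong[OF expand[of v], of J] by (simp add: J_simps)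
  then show "x1 (J v) = - x2 v" "x2 (J v) = x1 v" "x3 (J v) = - x4 v" "x4 (J v) = x3 v"
    by simp_all
qed

text \<open>
  Sums and differences of the complementary components \<open>\<alpha>\<^sub>1\<^sub>2, \<alpha>\<^sub>3\<^sub>4\<close> (and likewise for the other
  two pairs) diagonalise the wedge product; on these coordinates \<open>split_form\<close> is twice the wedge
  product. Here \<open>J\<close> fixes \<open>\<alpha>\<^sub>1\<^sub>2\<close> and \<open>\<alpha>\<^sub>3\<^sub>4\<close>, exchanges \<open>\<alpha>\<^sub>1\<^sub>3\<close> with \<open>\<alpha>\<^sub>2\<^sub>4\<close>, and exchanges \<open>\<alpha>\<^sub>1\<^sub>4\<close>
  with \<open>- \<alpha>\<^sub>2\<^sub>3\<close>; so only the middle pair changes its sign under \<open>J\<close>.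
\<close>

definition coords :: "'a form2 \<Rightarrow> coords2" where
  "coords \<alpha> = (\<alpha> e (J e) + \<alpha> f (J f),
     (\<alpha> e (J f) + \<alpha> (J e) f, \<alpha> e f - \<alpha> (J e) (J f)),
     (\<alpha> e (J e) - \<alpha> f (J f), \<alpha> e (J f) - \<alpha> (J e) f, \<alpha> e f + \<alpha> (J e) (J f)))"

definition form_of :: "coords2 \<Rightarrow> 'a form2" where
  "form_of = (\<lambda>(t, (w1, w2), (m1, m2, m3)) u v.
     ((t + m1) * (x1 u * x2 v - x2 u * x1 v) + (t - m1) * (x3 u * x4 v - x4 u * x3 v) +
      (w1 + m2) * (x1 u * x4 v - x4 u * x1 v) + (w1 - m2) * (x2 u * x3 v - x3 u * x2 v) +
      (m3 + w2) * (x1 u * x3 v - x3 u * x1 v) + (m3 - w2) * (x2 u * x4 v - x4 u * x2 v)) / 2)"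

lemma form_of_Forms2: "form_of z \<in> Forms2"
proof -
  obtain t w1 w2 m1 m2 m3 where z: "z = (t, (w1, w2), (m1, m2, m3))" by (cases z) auto
  show ?thesis by (auto simp: z form_of_def Forms2_def bilinear_def linear_iff simp flip: add_divide_distrib)
      (simp_all add: algebra_simps)
qed

lemma form_of_linear:
  "form_of (x + y) = (\<lambda>u v. form_of x u v + form_of y u v)"
  "form_of (c *\<^sub>R x) = (\<lambda>u v. c * form_of x u v)"
  "form_of 0 = (\<lambda>u v. 0)"
proof -
  obtain t w1 w2 m1 m2 m3 where x: "x = (t, (w1, w2), (m1, m2, m3))" by (cases x) auto
  obtain t' w1' w2' m1' m2' m3' where y: "y = (t', (w1', w2'), (m1', m2', m3'))" by (cases y) auto
  show "form_of (x + y) = (\<lambda>u v. form_of x u v + form_of y u v)"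
    by (intro ext) (simp add: x y form_of_def algebra_simps flip: add_divide_distrib)
  show "form_of (c *\<^sub>R x) = (\<lambda>u v. c * form_of x u v)"
    by (intro ext) (simp add: x form_of_def algebra_simps)
  show "form_of 0 = (\<lambda>u v. 0)" by (intro ext) (simp add: zero_prod_def form_of_def)
qed

lemma coords_form_of [simp]: "coords (form_of z) = z"
proof -
  obtain t w1 w2 m1 m2 m3 where z: "z = (t, (w1, w2), (m1, m2, m3))" by (cases z) auto
  show ?thesis by (simp add: z form_of_def coords_def field_simps)
qed

lemma form_of_inject: "form_of x = form_of y \<longleftrightarrow> x = y"
  by (auto dest: arg_cong[of _ _ coords])

lemma form2_expand:
  assumes "\<alpha> \<in> Forms2"
  shows "\<alpha> u v = \<alpha> e (J e) * (x1 u * x2 v - x2 u * x1 v) + \<alpha> f (J f) * (x3 u * x4 v - x4 u * x3 v) +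
     \<alpha> e (J f) * (x1 u * x4 v - x4 u * x1 v) + \<alpha> (J e) f * (x2 u * x3 v - x3 u * x2 v) +
     \<alpha> e f * (x1 u * x3 v - x3 u * x1 v) + \<alpha> (J e) (J f) * (x2 u * x4 v - x4 u * x2 v)"
proof -
  have anti: "\<alpha> (J e) e = - \<alpha> e (J e)" "\<alpha> f e = - \<alpha> e f" "\<alpha> (J f) e = - \<alpha> e (J f)"
    "\<alpha> f (J e) = - \<alpha> (J e) f" "\<alpha> (J f) (J e) = - \<alpha> (J e) (J f)" "\<alpha> (J f) f = - \<alpha> f (J f)"
    by (rule Forms2_anti[OF assms])+
  have "\<alpha> u v = \<alpha> (x1 u *\<^sub>R e + x2 u *\<^sub>R J e + x3 u *\<^sub>R f + x4 u *\<^sub>R J f)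
    (x1 v *\<^sub>R e + x2 v *\<^sub>R J e + x3 v *\<^sub>R f + x4 v *\<^sub>R J f)"
    by (simp flip: expand)
  also have "\<dots> = \<alpha> e (J e) * (x1 u * x2 v - x2 u * x1 v) + \<alpha> f (J f) * (x3 u * x4 v - x4 u * x3 v) +
     \<alpha> e (J f) * (x1 u * x4 v - x4 u * x1 v) + \<alpha> (J e) f * (x2 u * x3 v - x3 u * x2 v) +
     \<alpha> e f * (x1 u * x3 v - x3 u * x1 v) + \<alpha> (J e) (J f) * (x2 u * x4 v - x4 u * x2 v)"
    by (simp only: Forms2D[OF assms] anti) (simp add: algebra_simps)
  finally show ?thesis .
qed

lemma form_of_coords:
  assumes "\<alpha> \<in> Forms2"
  shows "form_of (coords \<alpha>) = \<alpha>"
  by (intro ext, subst form2_expand[OF assms]) (simp add: form_of_def coords_def field_simps)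

lemma form_of_J: "form_of (t, w, m) (J u) (J v) = form_of (t, - w, m) u v"
  by (cases w, cases m) (auto simp: form_of_def field_simps)

lemma form_of_inv_part: "form_of z \<in> Forms2_J J 1 \<longleftrightarrow> z \<in> inv_part"
proof -
  obtain t w m where z: "z = (t, w, m)" by (cases z) auto
  have "form_of z \<in> Forms2_J J 1 \<longleftrightarrow> form_of (t, - w, m) = form_of (t, w, m)"
    by (simp add: Forms2_J_def z form_of_J form_of_Forms2 fun_eq_iff)
  also have "\<dots> \<longleftrightarrow> w = 0" by (cases w) (auto simp: form_of_inject zero_prod_def)
  finally show ?thesis by (simp add: z inv_part_def)
qed

lemma form_of_anti_part: "form_of z \<in> Forms2_J J (- 1) \<longleftrightarrow> z \<in> anti_part"
proof -
  obtain t w m where z: "z = (t, w, m)" by (cases z) auto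
  have "- 1 * form_of z u v = form_of (- t, - w, - m) u v" for u v
    using form_of_linear(2)[of "-1" z] by (simp add: z)
  then have "form_of z \<in> Forms2_J J (- 1) \<longleftrightarrow> form_of (t, - w, m) = form_of (- t, - w, - m)"
    by (simp add: Forms2_J_def form_of_Forms2 fun_eq_iff) (simp add: z form_of_J)
  also have "\<dots> \<longleftrightarrow> t = 0 \<and> m = 0" by (cases m) (auto simp: form_of_inject zero_prod_def)
  finally show ?thesis by (simp add: z anti_part_def)
qed

lemma wedge22_form_of:
  "wedge22 (form_of x) (form_of y) e (J e) f (J f) = split_form x y / 2"
proof -
  obtain t w1 w2 m1 m2 m3 where x: "x = (t, (w1, w2), (m1, m2, m3))" by (cases x) auto
  obtain t' w1' w2' m1' m2' m3' where y: "y = (t', (w1', w2'), (m1', m2', m3'))" by (cases y) auto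
  show ?thesis by (simp add: x y wedge22_def form_of_def split_form_def)
      (simp add: add_divide_distrib diff_divide_distrib algebra_simps)
qed

text \<open>
  The \<open>J\<close>-invariant component of \<open>\<alpha>\<close> is encoded by the Hermitian form with \<open>v \<mapsto> \<alpha> v (J v)\<close> as its
  quadratic form. Its matrix has diagonal \<open>a, b\<close> and an off-diagonal entry of squared modulus
  \<open>c\<^sup>2 + d\<^sup>2\<close>, and the claim is that the determinant \<open>a b - c\<^sup>2 - d\<^sup>2\<close> is positive.
\<close>

lemma tame_form_split_pos:
  assumes "\<alpha> \<in> Forms2" "\<And>v. v \<noteq> 0 \<Longrightarrow> \<alpha> v (J v) > 0" "z = coords \<alpha>"
  shows "split_form (fst z, 0 :: real \<times> real, snd (snd z)) (fst z, 0, snd (snd z)) > 0"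
proof -
  define a b p q r s where abs: "a = \<alpha> e (J e)" "b = \<alpha> f (J f)" "p = \<alpha> e (J f)" "q = \<alpha> (J e) f"
    "r = \<alpha> e f" "s = \<alpha> (J e) (J f)"
  define c d where cd: "c = (r + s) / 2" "d = (p - q) / 2"
  \<comment> \<open>the vector at which completing the square leaves \<open>b\<close> times the determinant\<close>
  define v where "v = b *\<^sub>R e + (- d) *\<^sub>R f + c *\<^sub>R J f"
  have "f \<noteq> 0"
  proof
    assume "f = 0"
    then have "x3 f = x3 0" by (rule arg_cong)
    then show False by simp
  qed
  then have b: "b > 0" using assms(2) by (simp add: abs)
  have x: "x1 v = b" "x2 v = 0" "x3 v = - d" "x4 v = c" by (simp_all add: v_def)
  then have "v \<noteq> 0" using b by auto
  then have "\<alpha> v (J v) > 0" by (rule assms(2))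
  moreover have "\<alpha> v (J v) = a * (b * b) + b * (d * d + c * c) - b * d * (p - q) - b * c * (r + s)"
    by (subst form2_expand[OF assms(1)]) (simp add: x flip: abs, simp add: algebra_simps)
  moreover have "\<dots> = b * (a * b - c * c - d * d)"
    by (simp add: cd field_simps)
  ultimately have "a * b - c * c - d * d > 0" using b by (simp add: zero_less_mult_iff)
  moreover have "split_form (fst z, 0 :: real \<times> real, snd (snd z)) (fst z, 0, snd (snd z)) =
      4 * (a * b - c * c - d * d)"
    by (simp add: assms(3) coords_def split_form_def abs[symmetric] cd) (simp add: field_simps)
  ultimately show ?thesis by simp
qed

text \<open>
  The form with coordinates \<open>(2, 0, 0)\<close> is the standard Hermitian one; the anti-invariant summand
  \<open>w\<close> does not change the values on the pairs \<open>(v, J v)\<close>.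
\<close>

lemma form_of_tame: 
  assumes "v \<noteq> 0" shows "form_of (2, w, 0) v (J v) > 0"
proof -
  have "form_of (2, w, 0) v (J v) = (x1 v)\<^sup>2 + (x2 v)\<^sup>2 + (x3 v)\<^sup>2 + (x4 v)\<^sup>2"
    by (cases w) (simp add: form_of_def zero_prod_def power2_eq_square field_simps)
  moreover have "x1 v \<noteq> 0 \<or> x2 v \<noteq> 0 \<or> x3 v \<noteq> 0 \<or> x4 v \<noteq> 0"
  proof (rule ccontr)
    assume "\<not> ?thesis"
    then have "v = 0" by (subst expand) simp
    then show False using assms by simp
  qed
  ultimately show ?thesis
    by (auto simp: add_pos_nonneg add_nonneg_pos)
qed

end

section \<open>Exact and closed forms of a unimodular Lie algebra\<close>

lemma pos_dim_scale:
  assumes "c > 0"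
  shows "pos_dim (\<lambda>x y. c * q x y) W = pos_dim q W"
  using assms by (simp add: pos_dim_def zero_less_mult_iff)

text \<open>
  An orientation frame for \<open>J\<close> on a unimodular Lie algebra; here the coordinates of exact forms become
  an instance of \<open>isotropic_subspace\<close>, and the classes of closed forms one of \<open>linear_presentation\<close>.
\<close>

locale unimodular_complex_frame = complex_frame J e f
  for J :: "'a::real_vector \<Rightarrow> 'a" and e f +
  fixes br :: "'a \<Rightarrow> 'a \<Rightarrow> 'a"
  assumes lie: "lie_bracket br" and unimod: "unimodular br"
begin

lemma br_bilinear: "bilinear br" and br_self [simp]: "br u u = 0"
  using lie by (simp_all add: lie_bracket_def)

lemma trace_br: "x1 (br u e) + x2 (br u (J e)) + x3 (br u f) + x4 (br u (J f)) = 0"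
proof -
  have "linear (br u)" using br_bilinear by (simp add: bilinear_def)
  then have "linear_trace (br u) = (\<Sum>c\<in>frame. representation frame (br u c) c)"
    by (rule linear_trace_basis[OF _ indep span]) simp
  then show ?thesis using unimod neqs by (simp add: unimodular_def x_defs add.assoc)
qed

lemma linear_expand:
  assumes "linear \<phi>"
  shows "\<phi> v = x1 v * \<phi> e + x2 v * \<phi> (J e) + x3 v * \<phi> f + x4 v * \<phi> (J f)"
proof -
  have "\<phi> v = \<phi> (x1 v *\<^sub>R e + x2 v *\<^sub>R J e + x3 v *\<^sub>R f + x4 v *\<^sub>R J f)"
    by (rule arg_cong[OF expand])
  then show ?thesis by (simp add: linear_add[OF assms] linear_scale[OF assms])
qed

lemma d1_Forms2: "linear \<phi> \<Longrightarrow> d1 br \<phi> \<in> Forms2"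
  using exact2_subset_closed2[OF lie] by (auto simp: exact2_def closed2_def)

text \<open>
  This is the identity \<open>d\<phi> \<and> \<alpha> = \<phi> \<and> d\<alpha>\<close> evaluated on the frame. It says that \<open>d(\<phi> \<and> \<alpha>) = 0\<close>, and the
  traces of \<open>ad\<close> are what is needed for that.
\<close>

lemma wedge_exact:
  assumes \<alpha>: "\<alpha> \<in> Forms2" and \<phi>: "linear \<phi>"
  shows "wedge22 (d1 br \<phi>) \<alpha> e (J e) f (J f) =
    \<phi> e * d2 br \<alpha> (J e) f (J f) - \<phi> (J e) * d2 br \<alpha> e f (J f) +
    \<phi> f * d2 br \<alpha> e (J e) (J f) - \<phi> (J f) * d2 br \<alpha> e (J e) f"
proof -
  have anti: "br (J e) e = - br e (J e)" "br f e = - br e f" "br (J f) e = - br e (J f)"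
    "br f (J e) = - br (J e) f" "br (J f) (J e) = - br (J e) (J f)" "br (J f) f = - br f (J f)"
    by (rule bracket_anti[OF lie])+
  have tr: "x4 (br e (J f)) = - x2 (br e (J e)) - x3 (br e f)"
    "x4 (br (J e) (J f)) = x1 (br e (J e)) - x3 (br (J e) f)"
    "x4 (br f (J f)) = x1 (br e f) + x2 (br (J e) f)"
    "x3 (br f (J f)) = - x1 (br e (J f)) - x2 (br (J e) (J f))"
    using trace_br[of e] trace_br[of "J e"] trace_br[of f] trace_br[of "J f"] by (simp_all add: anti)
  have \<phi>_br: "\<phi> (br u v) = x1 (br u v) * \<phi> e + x2 (br u v) * \<phi> (J e) + x3 (br u v) * \<phi> f + x4 (br u v) * \<phi> (J f)"
    for u v by (rule linear_expand[OF \<phi>])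
  note \<alpha>_br = form2_expand[OF \<alpha>, of "br u v" for u v]
  show ?thesis
    unfolding wedge22_def d1_def d2_def \<phi>_br \<alpha>_br x_frame tr by (simp add: algebra_simps)
qed

text \<open>
  The values of \<open>d\<alpha>\<close> on four triples determine it, because it is alternating and trilinear.
\<close>

lemma closed2_frame:
  assumes \<alpha>: "\<alpha> \<in> Forms2"
    and zero: "d2 br \<alpha> (J e) f (J f) = 0" "d2 br \<alpha> e f (J f) = 0"
      "d2 br \<alpha> e (J e) (J f) = 0" "d2 br \<alpha> e (J e) f = 0"
  shows "\<alpha> \<in> closed2 br"
proof -
  let ?d = "d2 br \<alpha>"
  have alt: "?d u u w = 0" "?d u v v = 0" "?d u v u = 0" for u v w
    using bracket_anti[OF lie, of v u] by (simp_all add: d2_def Forms2D[OF \<alpha>] Forms2_0[OF \<alpha>])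
  have swap: "?d v u w = - ?d u v w" "?d u w v = - ?d u v w" for u v w
    using bracket_anti[OF lie, of v u] bracket_anti[OF lie, of w v] by (simp_all add: d2_def Forms2D[OF \<alpha>])
  have perm: "?d a b c = 0 \<Longrightarrow> ?d a c b = 0 \<and> ?d b a c = 0 \<and> ?d b c a = 0 \<and> ?d c a b = 0 \<and> ?d c b a = 0"
    for a b c using swap by (metis neg_equal_0_iff_equal)
  have basis: "?d u v w = 0" if "u \<in> frame" "v \<in> frame" "w \<in> frame" for u v w
    using that alt perm[OF zero(1)] perm[OF zero(2)] perm[OF zero(3)] perm[OF zero(4)] zero by auto
  have lin: "linear (\<lambda>u. ?d u v w)" "linear (\<lambda>v. ?d u v w)" "linear (\<lambda>w. ?d u v w)" for u v w
    using br_bilinear unfolding linear_iff d2_def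
    by (simp_all add: bilinear_ladd bilinear_radd bilinear_lmul bilinear_rmul Forms2D[OF \<alpha>] algebra_simps)
  have on_span: "g u = 0" if "linear g" "\<And>b. b \<in> frame \<Longrightarrow> g b = 0" for g :: "'a \<Rightarrow> real" and u
    using linear_eq_0_on_span[OF that(1), of frame u] that(2) span by auto
  have "?d u v w = 0" if "v \<in> frame" "w \<in> frame" for u v w
    by (rule on_span[OF lin(1)]) (rule basis[OF _ that])
  then have "?d u v w = 0" if "w \<in> frame" for u v w
    by (rule on_span[OF lin(2)]) (use that in auto)
  then have "?d u v w = 0" for u v w
    by (rule on_span[OF lin(3)])
  then show ?thesis using \<alpha> by (auto simp: closed2_def fun_eq_iff)
qed

definition exact_coords :: "coords2 set" where
  "exact_coords = {z. form_of z \<in> exact2 br}"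

text \<open>
  Closed forms are the orthogonal complement of the exact ones: in \<open>wedge_exact\<close> the four values of
  \<open>d\<alpha>\<close> are separated by letting \<open>\<phi>\<close> run over the dual frame.
\<close>

lemma form_of_closed2: "form_of z \<in> closed2 br \<longleftrightarrow> z \<in> form_orth exact_coords"
proof
  assume "form_of z \<in> closed2 br"
  then have d: "d2 br (form_of z) = (\<lambda>u v w. 0)" by (simp add: closed2_def)
  have "split_form b z = 0" if "b \<in> exact_coords" for b
  proof -
    obtain \<phi> where \<phi>: "linear \<phi>" "form_of b = d1 br \<phi>"
      using \<open>b \<in> exact_coords\<close> by (auto simp: exact_coords_def exact2_def)
    then have "split_form b z / 2 = wedge22 (d1 br \<phi>) (form_of z) e (J e) f (J f)"
      by (simp flip: wedge22_form_of)
    also have "\<dots> = 0" by (simp add: wedge_exact[OF form_of_Forms2 \<phi>(1)] d)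
    finally show ?thesis by simp
  qed
  then show "z \<in> form_orth exact_coords" by (simp add: form_orth_def)
next
  assume z: "z \<in> form_orth exact_coords"
  have "wedge22 (d1 br \<phi>) (form_of z) e (J e) f (J f) = 0" if "linear \<phi>" for \<phi>
  proof -
    let ?b = "coords (d1 br \<phi>)"
    have b: "form_of ?b = d1 br \<phi>" by (rule form_of_coords[OF d1_Forms2[OF that]])
    then have "?b \<in> exact_coords" using that by (auto simp: exact_coords_def exact2_def)
    then have "split_form ?b z = 0" using z by (simp add: form_orth_def)
    then show ?thesis using wedge22_form_of[of ?b z] b by simp
  qed
  note this[OF linear_x(1)] this[OF linear_x(2)] this[OF linear_x(3)] this[OF linear_x(4)]
  then show "form_of z \<in> closed2 br"
    by (intro closed2_frame form_of_Forms2)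
      (simp_all add: wedge_exact[OF form_of_Forms2 linear_x(1)] wedge_exact[OF form_of_Forms2 linear_x(2)]
        wedge_exact[OF form_of_Forms2 linear_x(3)] wedge_exact[OF form_of_Forms2 linear_x(4)])
qed

lemma subspace_exact_coords: "subspace exact_coords"
proof (rule subspaceI)
  have B: "submodule class_ring (exact2 br) (closed2_space br)"
    using exact2_subspace[OF lie] by (simp add: VectorSpace.subspace_def)
  note B = submodule.m_closed[OF B] submodule.zero_closed[OF B] submodule.smult_closed[OF B]
  show "0 \<in> exact_coords"
    using B(2) by (simp add: exact_coords_def form_of_linear closed2_space_def forms2_space_def)
  show "x + y \<in> exact_coords" if "x \<in> exact_coords" "y \<in> exact_coords" for x y
    using B(1)[of "form_of x" "form_of y"] that
    by (simp add: exact_coords_def form_of_linear closed2_space_def forms2_space_def)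
  show "c *\<^sub>R x \<in> exact_coords" if "x \<in> exact_coords" for c x
    using B(3)[of c "form_of x"] that
    by (simp add: exact_coords_def form_of_linear closed2_space_def forms2_space_def)
qed

sublocale isotropic_subspace exact_coords
proof
  show "exact_coords \<subseteq> form_orth exact_coords"
    using exact2_subset_closed2[OF lie] form_of_closed2 by (auto simp: exact_coords_def)
qed (simp_all add: subspace_exact_coords)

definition coh_of :: "coords2 \<Rightarrow> 'a form2 set" where
  "coh_of z = coh_class br (form_of z)"

lemma exact2_image: "exact2 br = form_of ` exact_coords"
proof -
  have "\<alpha> \<in> form_of ` exact_coords" if "\<alpha> \<in> exact2 br" for \<alpha>
    using that form_of_coords[of \<alpha>] d1_Forms2
    by (intro image_eqI[of _ _ "coords \<alpha>"]) (auto simp: exact_coords_def exact2_def)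
  then show ?thesis by (auto simp: exact_coords_def)
qed

lemma closed2_image: "closed2 br = form_of ` Z"
proof -
  have "\<alpha> \<in> form_of ` Z" if "\<alpha> \<in> closed2 br" for \<alpha>
    using that form_of_coords[of \<alpha>]
    by (intro image_eqI[of _ _ "coords \<alpha>"]) (auto simp: closed2_def simp flip: form_of_closed2)
  then show ?thesis using form_of_closed2 by auto
qed

lemma form_of_add: "form_of x \<oplus>\<^bsub>closed2_space br\<^esub> form_of y = form_of (x + y)"
  and form_of_smult: "c \<odot>\<^bsub>closed2_space br\<^esub> form_of x = form_of (c *\<^sub>R x)"
  by (simp_all add: closed2_space_def forms2_space_def form_of_linear)

lemma coh_of_eq: "coh_of z = (\<lambda>b. form_of (b + z)) ` exact_coords"
  by (auto simp: coh_of_def coh_class_def a_r_coset_def' exact2_image form_of_add)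

lemma in_coh_of: "form_of y \<in> coh_of z \<longleftrightarrow> y - z \<in> exact_coords"
  unfolding coh_of_eq by (force simp: form_of_inject image_iff)

lemma coh_of_add: "coh_of x \<oplus>\<^bsub>H2 br\<^esub> coh_of y = coh_of (x + y)"
proof -
  have "coh_of x \<oplus>\<^bsub>H2 br\<^esub> coh_of y = {form_of ((b + x) + (c + y)) | b c. b \<in> exact_coords \<and> c \<in> exact_coords}"
    by (simp add: H2_def quotient_space_def set_add_def' coh_of_eq form_of_add del: split_paired_Ex) blast
  also have "\<dots> = coh_of (x + y)"
  proof (intro equalityI subsetI)
    fix \<alpha> assume "\<alpha> \<in> {form_of ((b + x) + (c + y)) | b c. b \<in> exact_coords \<and> c \<in> exact_coords}"
    then obtain b c where bc: "b \<in> exact_coords" "c \<in> exact_coords" "\<alpha> = form_of ((b + x) + (c + y))"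
      by blast
    have "(b + x) + (c + y) - (x + y) = b + c" by simp
    then show "\<alpha> \<in> coh_of (x + y)"
      unfolding bc(3) in_coh_of using subspace_add[OF subspace_B bc(1,2)] by simp
  next
    fix \<alpha> assume "\<alpha> \<in> coh_of (x + y)"
    then obtain b where "b \<in> exact_coords" "\<alpha> = form_of ((b + x) + (0 + y))"
      by (auto simp: coh_of_eq add.assoc)
    then show "\<alpha> \<in> {form_of ((b + x) + (c + y)) | b c. b \<in> exact_coords \<and> c \<in> exact_coords}"
      using subspace_0[OF subspace_B] by blast
  qed
  finally show ?thesis .
qed

lemma coh_of_smult: "c \<odot>\<^bsub>H2 br\<^esub> coh_of x = coh_of (c *\<^sub>R x)"
proof -
  have "c \<odot>\<^bsub>H2 br\<^esub> coh_of x = {form_of (b + c *\<^sub>R (b' + x)) | b b'. b \<in> exact_coords \<and> b' \<in> exact_coords}"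
    by (simp add: H2_def quotient_space_def set_add_def' coh_of_eq form_of_add form_of_smult exact2_image
        image_image del: split_paired_Ex) blast
  also have "\<dots> = coh_of (c *\<^sub>R x)"
  proof (intro equalityI subsetI)
    fix \<alpha> assume "\<alpha> \<in> {form_of (b + c *\<^sub>R (b' + x)) | b b'. b \<in> exact_coords \<and> b' \<in> exact_coords}"
    then obtain b b' where b: "b \<in> exact_coords" "b' \<in> exact_coords" "\<alpha> = form_of (b + c *\<^sub>R (b' + x))"
      by blast
    have eq: "b + c *\<^sub>R (b' + x) - c *\<^sub>R x = b + c *\<^sub>R b'" by (simp add: scaleR_add_right)
    show "\<alpha> \<in> coh_of (c *\<^sub>R x)"
      unfolding b(3) in_coh_of eq
      by (rule subspace_add[OF subspace_B b(1) subspace_scale[OF subspace_B b(2)]])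
  next
    fix \<alpha> assume "\<alpha> \<in> coh_of (c *\<^sub>R x)"
    then obtain b where "b \<in> exact_coords" "\<alpha> = form_of (b + c *\<^sub>R (0 + x))"
      by (auto simp: coh_of_eq)
    then show "\<alpha> \<in> {form_of (b + c *\<^sub>R (b' + x)) | b b'. b \<in> exact_coords \<and> b' \<in> exact_coords}"
      using subspace_0[OF subspace_B] by blast
  qed
  finally show ?thesis .
qed

lemma carrier_H2: "carrier (H2 br) = coh_of ` Z"
  by (auto simp: H2_def quotient_space_def A_RCOSETS_def' closed2_space_def coh_of_def coh_class_def
      closed2_image)

sublocale H2: linear_presentation "H2 br" Z coh_of
  by (rule linear_presentation.intro, rule H2_vectorspace[OF lie])
    (auto simp: subspace_form_orth coh_of_add coh_of_smult carrier_H2)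

lemma kernel_coh_of: "H2.K = exact_coords"
proof -
  have "coh_of z = exact2 br \<longleftrightarrow> z \<in> exact_coords" for z
  proof
    assume "coh_of z = exact2 br"
    moreover have "form_of z \<in> coh_of z" by (simp add: in_coh_of subspace_0[OF subspace_B])
    ultimately show "z \<in> exact_coords" by (auto simp: exact_coords_def)
  next
    assume z: "z \<in> exact_coords"
    have "(\<lambda>b. b + z) ` exact_coords = exact_coords"
    proof (intro equalityI subsetI)
      fix b assume "b \<in> exact_coords"
      then have "b - z \<in> exact_coords" "b = (b - z) + z" using subspace_diff[OF subspace_B _ z] by simp_all
      then show "b \<in> (\<lambda>b. b + z) ` exact_coords" by blast
    qed (use subspace_add[OF subspace_B _ z] in blast)
    moreover have "coh_of z = form_of ` (\<lambda>b. b + z) ` exact_coords"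
      by (simp only: coh_of_eq image_image)
    ultimately show "coh_of z = exact2 br" by (simp only: exact2_image)
  qed
  moreover have "\<zero>\<^bsub>H2 br\<^esub> = exact2 br" by (simp add: H2_def quotient_space_def)
  ultimately show ?thesis using isotropic by (auto simp: H2.K_def)
qed

lemma H_J_image:
  "H_J br J 1 = coh_of ` (Z \<inter> inv_part)" "H_J br J (- 1) = coh_of ` (Z \<inter> anti_part)"
  by (auto simp: H_J_def closed2_image coh_of_def form_of_inv_part form_of_anti_part intro!: imageI)

text \<open>
  The pairing does not depend on the representatives, because exact forms are orthogonal to closed
  ones. The factor \<open>1/2\<close> comes from the scale of the coordinates.
\<close>

lemma pairing_coh_of:
  assumes \<zeta>: "\<And>\<omega>. \<omega> \<in> Forms4 \<Longrightarrow> \<zeta> \<omega> = r * \<omega> e (J e) f (J f)" and "x \<in> Z" "y \<in> Z"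
  shows "pairing \<zeta> (coh_of x) (coh_of y) = r / 2 * split_form x y"
proof -
  have val: "\<zeta> (wedge22 (form_of (b + x)) (form_of (c + y))) = r / 2 * split_form x y"
    if "b \<in> exact_coords" "c \<in> exact_coords" for b c
  proof -
    have "split_form b c = 0" "split_form b y = 0" "split_form c x = 0"
      using that assms isotropicD by (auto simp: form_orth_def)
    then have "split_form (b + x) (c + y) = split_form x y"
      by (simp add: split_form_linear split_form_commute[of x c])
    then show ?thesis
      by (simp add: \<zeta>[OF wedge22_Forms4[OF form_of_Forms2 form_of_Forms2]] wedge22_form_of)
  qed
  have "{\<zeta> (wedge22 \<alpha> \<beta>) |\<alpha> \<beta>. \<alpha> \<in> coh_of x \<and> \<beta> \<in> coh_of y} = {r / 2 * split_form x y}"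
  proof (intro equalityI subsetI)
    fix t assume "t \<in> {\<zeta> (wedge22 \<alpha> \<beta>) |\<alpha> \<beta>. \<alpha> \<in> coh_of x \<and> \<beta> \<in> coh_of y}"
    then show "t \<in> {r / 2 * split_form x y}" unfolding coh_of_eq using val by blast
  next
    fix t assume "t \<in> {r / 2 * split_form x y}"
    then have "t = \<zeta> (wedge22 (form_of (0 + x)) (form_of (0 + y)))"
      using val[OF subspace_0[OF subspace_B] subspace_0[OF subspace_B]] by simp
    then show "t \<in> {\<zeta> (wedge22 \<alpha> \<beta>) |\<alpha> \<beta>. \<alpha> \<in> coh_of x \<and> \<beta> \<in> coh_of y}"
      unfolding coh_of_eq using subspace_0[OF subspace_B] by blast
  qed
  then show ?thesis by (simp add: pairing_def)
qed

lemma tamed_iff: "tamed br J \<longleftrightarrow> exact_coords \<inter> inv_part = {0}"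
proof
  assume "tamed br J"
  then obtain \<phi> where \<phi>: "\<phi> \<in> closed2 br" "\<And>v. v \<noteq> 0 \<Longrightarrow> \<phi> v (J v) > 0"
    by (auto simp: tamed_def)
  have F: "\<phi> \<in> Forms2" using \<phi>(1) by (simp add: closed2_def)
  then have "coords \<phi> \<in> Z" using \<phi>(1) by (simp add: form_of_coords flip: form_of_closed2)
  then show "exact_coords \<inter> inv_part = {0}"
    using inv_projection_not_pos_if_meets tame_form_split_pos[OF F \<phi>(2) refl] by blast
next
  assume 0: "exact_coords \<inter> inv_part = {0}"
  have "(2, 0, 0) \<in> inv_part" by (simp add: inv_part_def)
  from exists_closed_lift[OF 0 this] obtain w where "(2, w, 0) \<in> Z" by auto
  then have "form_of (2, w, 0) \<in> closed2 br" by (simp add: form_of_closed2)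
  then show "tamed br J" using form_of_tame unfolding tamed_def by blast
qed

lemma exact2_inv_iff: "exact2 br \<inter> Forms2_J J 1 = {\<lambda>u v. 0} \<longleftrightarrow> exact_coords \<inter> inv_part = {0}"
proof -
  have "exact2 br \<inter> Forms2_J J 1 = form_of ` (exact_coords \<inter> inv_part)"
    by (auto simp: exact2_image form_of_inv_part)
  moreover have "inj form_of" by (rule injI) (simp add: form_of_inject)
  ultimately show ?thesis
    using inj_image_eq_iff[of form_of "exact_coords \<inter> inv_part" "{0}"] by (simp add: form_of_linear)
qed

end

section \<open>Characterisations of tameness\<close>

theorem theorem3p7:
  fixes br :: "'a::real_vector \<Rightarrow> 'a \<Rightarrow> 'a" and J :: "'a \<Rightarrow> 'a"
    and \<zeta> :: "'a form4 \<Rightarrow> real"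
  assumes "dim (UNIV :: 'a set) = 4"
    and "lie_bracket br" and "unimodular br"
    and "almost_complex J"
    and "\<zeta> \<in> Multivectors4" and "\<exists>\<omega>\<in>Forms4. \<zeta> \<omega> \<noteq> 0" and "induces_orientation J \<zeta>"
  shows "(tamed br J \<longleftrightarrow> exact2 br \<inter> Forms2_J J 1 = {\<lambda>u v. 0}) \<and>
         (tamed br J \<longleftrightarrow> h_J br J 1 = b_plus br \<zeta> + 1) \<and>
         (tamed br J \<longleftrightarrow> int (h_J br J (- 1)) = int (b_plus br \<zeta>) - 1) \<and>
         (tamed br J \<longleftrightarrow> signature (H2 br) (pairing \<zeta>) (H_J br J 1) = (1, b_plus br \<zeta>))"
proof -
  obtain e f r where frame: "distinct [e, J e, f, J f]" "independent {e, J e, f, J f}"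
      "span {e, J e, f, J f} = UNIV" and r: "r > 0"
      and \<zeta>: "\<And>\<omega>. \<omega> \<in> Forms4 \<Longrightarrow> \<zeta> \<omega> = r * \<omega> e (J e) f (J f)"
    using assms(7) by (auto simp: induces_orientation_def)
  interpret unimodular_complex_frame J e f br
    using assms frame by unfold_locales auto
  define s where "s = r / 2"
  have s: "s > 0" using r by (simp add: s_def)
  let ?q = "\<lambda>x y. s * split_form x y"
  let ?d = "dim (exact_coords \<inter> inv_part)" and ?k = "dim exact_coords"
  have p: "pairing \<zeta> (coh_of x) (coh_of y) = ?q x y" if "x \<in> Z" "y \<in> Z" for x y
    using pairing_coh_of[of \<zeta> r x y] \<zeta> that by (simp only: s_def)
  have K: "\<not> ?q x x > 0" "\<not> - ?q x x > 0" if "x \<in> H2.K" for x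
    using isotropicD[of x x] that by (simp_all add: kernel_coh_of)
  have k: "?k \<le> 3" using dim_Z_pos_part by simp
  have b: "b_plus br \<zeta> = 3 - ?k"
    using H2.pos_index_image[OF subspace_form_orth order_refl, of "pairing \<zeta>" ?q, OF p K(1)]
    by (simp add: b_plus_def carrier_H2 pos_dim_scale[OF s] pos_dim_Z)
  have sub: "subspace (Z \<inter> inv_part)" "subspace (Z \<inter> anti_part)" by (intro subspaces)+
  have "Z \<inter> inv_part \<inter> H2.K = exact_coords \<inter> inv_part" using isotropic by (auto simp: kernel_coh_of)
  \<comment> \<open>this and \<open>h_minus\<close> are \<open>h\<^sub>J\<^sup>+ = b\<^sup>+ + 1 - d\<close> and \<open>h\<^sub>J\<^sup>- = b\<^sup>+ - 1 + d\<close>, free of subtraction\<close>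
  then have h_plus: "h_J br J 1 + ?d + ?k = 4"
    using H2.dim_image[OF sub(1)] dim_Z_inv_part by (simp add: h_J_def H_J_image)
  have "Z \<inter> anti_part \<inter> H2.K \<subseteq> {0}" using B_disjoint_anti_part by (auto simp: kernel_coh_of)
  then have h_minus: "h_J br J (- 1) + ?k + 1 = 3 + ?d"
    using H2.dim_image[OF sub(2)] dim_Z_anti_part by (simp add: h_J_def H_J_image dim_eq_0[THEN iffD2])
  have pos: "pos_index (H2 br) (pairing \<zeta>) (H_J br J 1) = (if exact_coords \<inter> inv_part = {0} then 1 else 0)"
    using H2.pos_index_image[OF sub(1) inf_le1, of "pairing \<zeta>" ?q, OF p K(1)]
    by (simp add: H_J_image pos_dim_scale[OF s] pos_dim_Z_inv_part)
  have neg: "neg_index (H2 br) (pairing \<zeta>) (H_J br J 1) = 3 - ?k"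
    using H2.pos_index_image[OF sub(1) inf_le1, of "\<lambda>x y. - pairing \<zeta> x y" "\<lambda>x y. - ?q x y"] p K(2)
      pos_dim_scale[OF s, of "\<lambda>x y. - split_form x y" "Z \<inter> inv_part"]
    by (simp add: neg_index_def H_J_image neg_dim_Z_inv_part)
  show ?thesis
    unfolding tamed_iff exact2_inv_iff signature_def pos neg b prod.inject inv_part_disjoint_iff
    using h_plus h_minus k by (auto simp del: dim_eq_0)
qed

end
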